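(* Let $X$ be a finite skew brace, $R=\mathfrak{R}_L(X)$ and $Q=X/R$. Let $\sigma=\pi(Q)$, and let $H$ be a Hall $\sigma$-subskew brace of $X$. Then $$X=R+H,\qquad |H\cap R|=|R|_\sigma,\qquad H/(H\cap R)\cong Q,\qquad\text{and}\qquad \mathfrak{R}_L(H)\leq H\cap R.$$ In particular, if both $(X,+)$ and $(X,\cdot)$ are solvable, such a Hall $\sigma$-subskew brace exists.
   Context: A skew (left) brace is a triple $X=(X,+,\cdot)$ such that $(X,+)$ and $(X,\cdot)$ are groups on the same set and $a\cdot(b+c)=a\cdot b-a+a\cdot c$ for all $a,b,c\in X$. A subskew brace is a subset that is a subgroup of both groups. Put $\lambda_a(b)=-a+a\cdot b$ and $a*b=\lambda_a(b)-b$; for subsets $S,T$, $S*T$ is the subgroup of $(X,+)$ generated by all $s*t$, $s\in S$, $t\in T$. An ideal of $X$ is a subgroup of $(X,+)$ that is invariant under every $\lambda_a$ and normal in both $(X,+)$ and $(X,\cdot)$. The left series is $X^1=X$, $X^{n+1}=X*X^n$; $X$ is left nilpotent if $X^n=0$ for some $n$. The left-nilpotent residual $\mathfrak{R}_L(Y)$ of a finite skew brace $Y$ is the intersection of all ideals $I$ of $Y$ such that $Y/I$ is left nilpotent. $\pi(Q)$ is the set of prime divisors of $|Q|$. For a set of primes $\sigma$, $|R|_\sigma$ is the largest divisor of $|R|$ all of whose prime divisors lie in $\sigma$. A Hall $\sigma$-subskew brace of $X$ is a subskew brace of order $|X|_\sigma$. $R+H$ is the set product in $(X,+)$; the isomorphism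 $H/(H\cap R)\cong Q$ is of skew braces. *)

theory Defs
  imports
    "HOL-Computational_Algebra.Primes"
    "HOL-Algebra.AbelCoset"
    "HOL-Algebra.Solvable_Groups"
begin

text \<open>
  The signature of a skew brace is the record of rings: the additive group is
  \<^term>\<open>add_monoid X\<close> (not assumed commutative) and the multiplicative group is the record
  itself, viewed as a monoid. The two neutral elements are separate record fields; the brace law
  forces them to coincide (put \<open>b = c = \<zero>\<close>).
\<close>

locale skew_brace =
  fixes X (structure)
  assumes additive_group: "group (add_monoid X)"
    and multiplicative_group: "group X"
    and brace_law: "\<lbrakk>a \<in> carrier X; b \<in> carrier X; c \<in> carrier X\<rbrakk> \<Longrightarrow>
      a \<otimes> (b \<oplus> c) = a \<otimes> b \<ominus> a \<oplus> a \<otimes> c"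

definition brace_lambda :: "('a, 'm) ring_scheme \<Rightarrow> 'a \<Rightarrow> 'a \<Rightarrow> 'a" where
  "brace_lambda X a b = (\<ominus>\<^bsub>X\<^esub> a) \<oplus>\<^bsub>X\<^esub> (a \<otimes>\<^bsub>X\<^esub> b)"

definition brace_star :: "('a, 'm) ring_scheme \<Rightarrow> 'a \<Rightarrow> 'a \<Rightarrow> 'a" where
  "brace_star X a b = brace_lambda X a b \<ominus>\<^bsub>X\<^esub> b"

definition brace_set_star :: "('a, 'm) ring_scheme \<Rightarrow> 'a set \<Rightarrow> 'a set \<Rightarrow> 'a set" where
  "brace_set_star X S T = generate (add_monoid X) {brace_star X s t | s t. s \<in> S \<and> t \<in> T}"

text \<open>For a subskew brace \<open>S\<close>, the induced skew brace is \<open>X\<lparr>carrier := S\<rparr>\<close>.\<close>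

definition subskew_brace :: "'a set \<Rightarrow> ('a, 'm) ring_scheme \<Rightarrow> bool" where
  "subskew_brace S X \<longleftrightarrow> subgroup S (add_monoid X) \<and> subgroup S X"

definition brace_ideal :: "'a set \<Rightarrow> ('a, 'm) ring_scheme \<Rightarrow> bool" where
  "brace_ideal I X \<longleftrightarrow>
     subgroup I (add_monoid X) \<and>
     (\<forall>a\<in>carrier X. \<forall>b\<in>I. brace_lambda X a b \<in> I) \<and>
     I \<lhd> add_monoid X \<and> I \<lhd> X"

text \<open>
  For an ideal \<open>I\<close> one has \<open>I + a = a + I = a \<cdot> I = I \<cdot> a\<close>, so additive and multiplicative
  cosets agree, and both operations on cosets are the operations on subsets. The definition is
  meaningful only when \<open>I\<close> is an ideal.
\<close>

definition brace_quotient :: "('a, 'm) ring_scheme \<Rightarrow> 'a set \<Rightarrow> 'a set ring" where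
  "brace_quotient X I =
     \<lparr>carrier = a_rcosets\<^bsub>X\<^esub> I, mult = set_mult X, one = I, zero = I, add = set_add X\<rparr>"

definition brace_isomorphic :: "('a, 'm) ring_scheme \<Rightarrow> ('b, 'n) ring_scheme \<Rightarrow> bool" where
  "brace_isomorphic X Y \<longleftrightarrow> (\<exists>f. f \<in> iso (add_monoid X) (add_monoid Y) \<and> f \<in> iso X Y)"

text \<open>Indices start at 0 here: \<open>left_series X n\<close> is the term usually written \<open>X\<^sup>n\<^sup>+\<^sup>1\<close>.\<close>

primrec left_series :: "('a, 'm) ring_scheme \<Rightarrow> nat \<Rightarrow> 'a set" where
  "left_series X 0 = carrier X"
| "left_series X (Suc n) = brace_set_star X (carrier X) (left_series X n)"

definition left_nilpotent :: "('a, 'm) ring_scheme \<Rightarrow> bool" where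
  "left_nilpotent X \<longleftrightarrow> (\<exists>n. left_series X n = {\<zero>\<^bsub>X\<^esub>})"

definition left_nilpotent_residual :: "('a, 'm) ring_scheme \<Rightarrow> 'a set" where
  "left_nilpotent_residual X =
     \<Inter> {I. brace_ideal I X \<and> left_nilpotent (brace_quotient X I)}"

definition prime_divisors_of_order :: "('a, 'm) ring_scheme \<Rightarrow> nat set" where
  "prime_divisors_of_order X = {p. prime p \<and> p dvd order X}"

text \<open>Intended for \<open>n > 0\<close>, where the set of divisors is finite.\<close>

definition primes_part :: "nat set \<Rightarrow> nat \<Rightarrow> nat" where
  "primes_part \<sigma> n = Max {d. d dvd n \<and> (\<forall>p. prime p \<and> p dvd d \<longrightarrow> p \<in> \<sigma>)}"

definition hall_subskew_brace :: "nat set \<Rightarrow> 'a set \<Rightarrow> ('a, 'm) ring_scheme \<Rightarrow> bool" where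
  "hall_subskew_brace \<sigma> H X \<longleftrightarrow> subskew_brace H X \<and> card H = primes_part \<sigma> (order X)"

end

theory Submission
  imports Defs "HOL-Algebra.Sylow" "HOL-Algebra.Multiplicative_Group" "HOL-Number_Theory.Cong"
begin

text \<open>
  The statements about a given \<open>H\<close> come from counting. The residual \<open>R\<close> is an ideal with left nilpotent
  quotient \<open>Q\<close>, since finitely many ideals define it. As \<open>\<sigma>\<close> contains all prime divisors of \<open>|Q|\<close>, the number
  \<open>|X|\<^sub>\<sigma>\<close> is \<open>|R|\<^sub>\<sigma> |Q|\<close>. The order of \<open>H\<close> is the product of the order of its image in \<open>Q\<close> and of
  \<open>|H \<inter> R|\<close>, which are at most \<open>|Q|\<close> and \<open>|R|\<^sub>\<sigma>\<close>; hence both bounds are attained, \<open>H\<close> maps onto \<open>Q\<close>, and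
  the isomorphism theorem identifies \<open>H/(H \<inter> R)\<close> with \<open>Q\<close>
  (\<open>hall_subskew_brace_supplements_ideal\<close>, \<open>brace_quotient_isomorphic_if_surjective\<close>). The left series of
  \<open>H\<close> is contained in that of \<open>X\<close>, which bounds the residual of \<open>H\<close>.

  Existence holds for every set of primes (\<open>hall_subskew_brace_exists\<close>). The semidirect product of \<open>(X, +)\<close>
  by \<open>(X, \<cdot>)\<close> acting through \<open>\<lambda>\<close> is solvable, and it contains besides the two factors the diagonal
  \<open>{(g, g)}\<close>, another copy of \<open>(X, \<cdot>)\<close>. By Hall's theorem and a factorisation of the semidirect product, one
  of its Hall subgroups meets the multiplicative factor and the diagonal in Hall subgroups of
  these. Comparing orders shows that these two intersections and the one with the additive factor are
  given by one and the same subset of \<open>X\<close>, which is therefore a subgroup for both operations.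

  Hall's theorem itself (\<open>hall_theorem_solvable\<close>) is obtained by climbing the derived series. Each
  step has an abelian kernel, where averaging a cocycle over the quotient gives a crossed homomorphism
  whose zero set is a Hall subgroup, and where crossed homomorphisms from groups of coprime order are
  coboundaries, which gives conjugacy.
\<close>

section \<open>Numbers with prime divisors in a given set\<close>

definition prime_support_in :: "nat set \<Rightarrow> nat \<Rightarrow> bool" where
  "prime_support_in \<sigma> n \<longleftrightarrow> (\<forall>p. prime p \<and> p dvd n \<longrightarrow> p \<in> \<sigma>)"

lemma prime_support_in_dvd:
  "prime_support_in \<sigma> n \<Longrightarrow> m dvd n \<Longrightarrow> prime_support_in \<sigma> m"
  unfolding prime_support_in_def using dvd_trans by blast

lemma prime_support_in_mult:
  "prime_support_in \<sigma> m \<Longrightarrow> prime_support_in \<sigma> n \<Longrightarrow> prime_support_in \<sigma> (m * n)"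
  unfolding prime_support_in_def using prime_dvd_mult_iff by blast

lemma prime_support_in_imp_coprime:
  fixes m n :: nat
  assumes "prime_support_in \<sigma> m" "prime_support_in (- \<sigma>) n"
  shows "coprime m n"
proof (rule ccontr)
  assume "\<not> coprime m n"
  then have "gcd m n \<noteq> 1" by (simp add: coprime_iff_gcd_eq_1)
  then obtain p where "prime p" "p dvd gcd m n" using prime_factor_nat by blast
  then show False using assms unfolding prime_support_in_def by (metis ComplD gcd_nat.boundedE)
qed

lemma prime_support_split:
  fixes n :: nat
  assumes "n > 0"
  obtains a b where "n = a * b" "prime_support_in \<sigma> a" "prime_support_in (- \<sigma>) b"
  using assms
proof (induction n arbitrary: thesis rule: less_induct)
  case (less n)
  show ?case
  proof (cases "n = 1")
    case True
    then show ?thesis using less.prems(1)[of 1 1] by (auto simp: prime_support_in_def)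
  next
    case False
    then obtain p where p: "prime p" "p dvd n" using prime_factor_nat by blast
    then obtain k where k: "n = p * k" by auto
    have "k < n" "k > 0" using k less.prems(2) prime_gt_1_nat[OF p(1)] by auto
    then obtain a b where ab: "k = a * b" "prime_support_in \<sigma> a" "prime_support_in (- \<sigma>) b"
      using less.IH by blast
    show ?thesis
    proof (cases "p \<in> \<sigma>")
      case True
      have "prime_support_in \<sigma> p"
        unfolding prime_support_in_def using True p(1) primes_dvd_imp_eq by blast
      then show ?thesis using less.prems(1)[of "p * a" b] ab k prime_support_in_mult by auto
    next
      case False
      have "prime_support_in (- \<sigma>) p"
        unfolding prime_support_in_def using False p(1) primes_dvd_imp_eq by blast
      then show ?thesis using less.prems(1)[of a "p * b"] ab k prime_support_in_mult by auto
    qed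
  qed
qed

lemma primes_part_properties:
  assumes "n > 0"
  shows "primes_part \<sigma> n dvd n" and "prime_support_in \<sigma> (primes_part \<sigma> n)"
    and "\<And>d. d dvd n \<Longrightarrow> prime_support_in \<sigma> d \<Longrightarrow> d \<le> primes_part \<sigma> n"
proof -
  let ?D = "{d. d dvd n \<and> (\<forall>p. prime p \<and> p dvd d \<longrightarrow> p \<in> \<sigma>)}"
  have fin: "finite ?D" using assms by (auto intro: finite_subset[of _ "{..n}"] dvd_imp_le)
  have "1 \<in> ?D" by auto
  then have "primes_part \<sigma> n \<in> ?D" unfolding primes_part_def using Max_in[OF fin] by blast
  then show "primes_part \<sigma> n dvd n" and "prime_support_in \<sigma> (primes_part \<sigma> n)"
    unfolding prime_support_in_def by auto
  show "d \<le> primes_part \<sigma> n" if "d dvd n" "prime_support_in \<sigma> d" for d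
    using that Max_ge[OF fin] unfolding primes_part_def prime_support_in_def by auto
qed

lemma primes_part_eqI:
  assumes "n > 0" "a dvd n" "prime_support_in \<sigma> a" "prime_support_in (- \<sigma>) (n div a)"
  shows "primes_part \<sigma> n = a"
proof (rule antisym)
  show "a \<le> primes_part \<sigma> n" using primes_part_properties(3) assms by blast
  have "coprime (primes_part \<sigma> n) (n div a)"
    using prime_support_in_imp_coprime primes_part_properties(2) assms by blast
  moreover have "primes_part \<sigma> n dvd a * (n div a)"
    using primes_part_properties(1)[OF assms(1)] assms(2) by simp
  ultimately have "primes_part \<sigma> n dvd a" by (simp add: coprime_dvd_mult_left_iff)
  then show "primes_part \<sigma> n \<le> a" using assms(1,2) by (auto intro: dvd_imp_le dvd_pos_nat)
qed

section \<open>Orders of finite groups\<close>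

lemma (in group) card_subgroup_dvd_order:
  "subgroup S G \<Longrightarrow> card S dvd order G"
  using lagrange[of S] by (metis dvd_triv_right)

text \<open>
  Cauchy's theorem in the form in which it controls prime supports: the Sylow theorem supplies a
  nontrivial element whose order divides both \<open>p\<close> and \<open>b\<close>.
\<close>

lemma (in group) prime_dvd_exponent:
  assumes "finite (carrier G)" "prime p" "p dvd order G"
    and "\<And>x. x \<in> carrier G \<Longrightarrow> x [^] (b::nat) = \<one>"
  shows "p dvd b"
proof (rule ccontr)
  assume "\<not> p dvd b"
  then have cop: "coprime p b" using assms(2) by (simp add: prime_imp_coprime)
  obtain m where "order G = p ^ 1 * m" using assms(3) by auto
  then obtain P where P: "subgroup P G" "card P = p"
    using sylow_thm[OF assms(2) is_group, of 1 m] assms(1) by auto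
  interpret P: group "G\<lparr>carrier := P\<rparr>" using P(1) by (rule subgroup.subgroup_is_group) simp
  have "P = {\<one>}"
  proof -
    have "x = \<one>" if "x \<in> P" for x
    proof -
      have x: "x \<in> carrier G" using that P(1) by (rule subgroup.mem_carrier[rotated])
      have "x [^]\<^bsub>G\<lparr>carrier := P\<rparr>\<^esub> p = \<one>"
        using P.pow_order_eq_1[of x] that P(2) by (simp add: order_def)
      then have xp: "x [^] p = \<one>" by (metis nat_pow_consistent)
      have "ord x dvd p" "ord x dvd b"
        using pow_eq_id x xp assms(4)[OF x] by auto
      then have "ord x = 1" using cop coprime_common_divisor_nat by blast
      then show ?thesis using ord_eq_1 x by blast
    qed
    then show ?thesis using subgroup.one_closed[OF P(1)] by blast
  qed
  then have "card P = 1" by simp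
  then have "p = 1" using P(2) by argo
  then show False using assms(2) by simp
qed

lemma (in group_hom) card_image_times_card_kernel:
  assumes "finite (carrier G)"
  shows "card (h ` carrier G) * card (kernel G H h) = order G"
proof -
  let ?K = "kernel G H h"
  have fib: "{x \<in> carrier G. h x = y} = ?K #> g" if "g \<in> carrier G" "y = h g" for y g
  proof
    show "{x \<in> carrier G. h x = y} \<subseteq> ?K #> g"
    proof
      fix x assume "x \<in> {x \<in> carrier G. h x = y}"
      then have "x \<in> carrier G" "h x = h g" using that by auto
      then have "x \<otimes> inv g \<in> ?K" "x = (x \<otimes> inv g) \<otimes> g"
        using that by (auto simp: kernel_def G.m_assoc)
      then show "x \<in> ?K #> g" unfolding r_coset_def by blast
    qed
    show "?K #> g \<subseteq> {x \<in> carrier G. h x = y}"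
      using that by (auto simp: r_coset_def kernel_def)
  qed
  have "order G = (\<Sum>y\<in>h ` carrier G. card {x \<in> carrier G. h x = y})"
    unfolding order_def
    using card_image sum.image_gen[of "carrier G" "\<lambda>_. 1::nat" h] assms by (simp)
  also have "\<dots> = (\<Sum>y\<in>h ` carrier G. card ?K)"
  proof (rule sum.cong)
    fix y assume "y \<in> h ` carrier G"
    then obtain g where g: "g \<in> carrier G" "y = h g" by auto
    show "card {x \<in> carrier G. h x = y} = card ?K"
      using fib[OF g] G.card_rcosets_equal[of "?K #> g" ?K] g
      by (simp add: G.rcosetsI kernel_def subset_iff)
  qed simp
  finally show ?thesis by simp
qed

lemma (in group_hom) card_image_dvd_card:
  assumes U: "subgroup U G" and fin: "finite U"
  shows "card (h ` U) dvd card U"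
proof -
  interpret U: group "G\<lparr>carrier := U\<rparr>" using subgroup.subgroup_is_group[OF U] by simp
  interpret hU: group_hom "G\<lparr>carrier := U\<rparr>" H h
    by unfold_locales (auto simp: hom_def subgroup.mem_carrier[OF U])
  show ?thesis
    using hU.card_image_times_card_kernel fin by (simp add: order_def) (metis dvd_triv_left)
qed

section \<open>Crossed homomorphisms into abelian groups\<close>

lemma (in comm_group) finprod_endomorphism:
  assumes "f \<in> hom G G" "finite A" "g \<in> A \<rightarrow> carrier G"
  shows "f (finprod G g A) = finprod G (\<lambda>x. f (g x)) A"
  using assms(2,3)
proof (induction A rule: finite_induct)
  case empty
  then show ?case using hom_one[OF assms(1)] is_group by simp
next
  case (insert a A)
  have g: "g \<in> A \<rightarrow> carrier G" "g a \<in> carrier G" using insert.prems by auto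
  then have "(\<lambda>x. f (g x)) \<in> A \<rightarrow> carrier G" "f (g a) \<in> carrier G"
    using hom_in_carrier[OF assms(1)] by auto
  then show ?case
    using insert g hom_mult[OF assms(1) g(2)] by simp
qed

lemma (in comm_group) nat_pow_cong:
  assumes "x \<in> carrier G" "x [^] (b::nat) = \<one>" "[k = l] (mod b)"
  shows "x [^] (k::nat) = x [^] l"
proof -
  have *: "x [^] k = x [^] (k mod b)" for k :: nat
  proof -
    have "x [^] k = x [^] (b * (k div b) + k mod b)" by simp
    also have "\<dots> = (x [^] b) [^] (k div b) \<otimes> x [^] (k mod b)"
      using assms(1) by (simp only: nat_pow_mult[symmetric] nat_pow_pow)
    finally show ?thesis using assms by simp
  qed
  show ?thesis using *[of k] *[of l] assms(3) by (simp add: cong_def)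
qed

text \<open>
  The vanishing of the first cohomology group in coprime order, which yields conjugacy of Hall
  subgroups. If \<open>P\<close> is the product of all values of \<open>f\<close>, reindexing by \<open>v \<mapsto> u v\<close> gives
  \<open>P = f(u)\<^sup>m \<cdot> act u P\<close> with \<open>m = |U|\<close>; a power of \<open>P\<close> whose exponent inverts \<open>m\<close> modulo \<open>b\<close> is then a
  solution \<open>q\<close>.
\<close>

lemma (in comm_group) coprime_crossed_hom_is_coboundary:
  fixes f :: "'u \<Rightarrow> 'a" and b :: nat
  assumes "group U" "finite (carrier U)"
    and act: "\<And>u. u \<in> carrier U \<Longrightarrow> act u \<in> hom G G"
    and f: "f \<in> carrier U \<rightarrow> carrier G"
    and cross: "\<And>u v. u \<in> carrier U \<Longrightarrow> v \<in> carrier U \<Longrightarrow> f (u \<otimes>\<^bsub>U\<^esub> v) = f u \<otimes> act u (f v)"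
    and exponent: "\<And>u. u \<in> carrier U \<Longrightarrow> f u [^] b = \<one>"
    and coprime: "coprime (order U) b"
  obtains q where "q \<in> carrier G" "q [^] b = \<one>"
    "\<And>u. u \<in> carrier U \<Longrightarrow> f u \<otimes> act u q = q"
proof -
  interpret U: group U by fact
  obtain s where s: "[order U * s = 1] (mod b)"
    using cong_solve_coprime_nat[OF coprime] by auto
  define P where "P = finprod G f (carrier U)"
  have P: "P \<in> carrier G" unfolding P_def using f by simp
  have pow_endo: "(\<lambda>x. x [^] n) \<in> hom G G" for n :: nat
    by (auto simp: hom_def nat_pow_distrib)
  have Pu: "P = f u [^] order U \<otimes> act u P" if u: "u \<in> carrier U" for u
  proof -
    have fu: "f u \<in> carrier G" using f u by auto
    have af: "(\<lambda>v. act u (f v)) \<in> carrier U \<rightarrow> carrier G"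
      using f hom_in_carrier[OF act[OF u]] by auto
    have "P = finprod G f ((\<lambda>v. u \<otimes>\<^bsub>U\<^esub> v) ` carrier U)"
      unfolding P_def using U.surj_const_mult[OF u] by simp
    also have "\<dots> = finprod G (\<lambda>v. f (u \<otimes>\<^bsub>U\<^esub> v)) (carrier U)"
      using f u by (intro finprod_reindex U.inj_on_cmult) auto
    also have "\<dots> = finprod G (\<lambda>v. f u \<otimes> act u (f v)) (carrier U)"
      using cross u f af fu by (intro finprod_cong') auto
    also have "\<dots> = finprod G (\<lambda>v. f u) (carrier U) \<otimes> finprod G (\<lambda>v. act u (f v)) (carrier U)"
      using fu af by (intro finprod_multf) auto
    also have "\<dots> = f u [^] order U \<otimes> act u P"
      unfolding P_def using finprod_endomorphism[OF act[OF u] assms(2) f]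
      by (simp only: order_def finprod_const[OF fu])
    finally show ?thesis .
  qed
  show ?thesis
  proof (rule that[of "P [^] s"])
    show "P [^] s \<in> carrier G" using P by simp
    have "P [^] b = \<one>"
      unfolding P_def using finprod_endomorphism[OF pow_endo assms(2) f, of b] exponent
      by (simp add: finprod_one_eqI)
    then show "(P [^] s) [^] b = \<one>"
      using P by (metis nat_pow_one nat_pow_pow mult.commute)
    fix u assume u: "u \<in> carrier U"
    interpret a: group_hom G G "act u"
      using act[OF u] by unfold_locales
    have fu: "f u \<in> carrier G" using f u by auto
    have aP: "act u P \<in> carrier G" using P by simp
    have "P [^] s = (f u [^] order U \<otimes> act u P) [^] s" using Pu[OF u] by simp
    also have "\<dots> = f u [^] (order U * s) \<otimes> act u (P [^] s)"
      using fu aP P by (simp add: nat_pow_distrib nat_pow_pow a.hom_nat_pow)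
    also have "f u [^] (order U * s) = f u"
      using nat_pow_cong[OF fu exponent[OF u] s] fu by simp
    finally show "f u \<otimes> act u (P [^] s) = P [^] s" by simp
  qed
qed

lemma (in group) conjugation_group_hom:
  assumes g: "g \<in> carrier G"
  shows "group_hom G G (\<lambda>x. g \<otimes> x \<otimes> inv g)"
proof unfold_locales
  show "(\<lambda>x. g \<otimes> x \<otimes> inv g) \<in> hom G G"
  proof (rule homI)
    fix x y assume xy: "x \<in> carrier G" "y \<in> carrier G"
    have "inv g \<otimes> (g \<otimes> (y \<otimes> inv g)) = y \<otimes> inv g"
      using xy(2) g by (metis inv_closed l_inv l_one m_assoc m_closed)
    then show "g \<otimes> (x \<otimes> y) \<otimes> inv g = (g \<otimes> x \<otimes> inv g) \<otimes> (g \<otimes> y \<otimes> inv g)"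
      using xy g by (simp add: m_assoc)
  qed (use g in simp)
qed

lemma (in group) conjugation_comp:
  assumes "g \<in> carrier G" "k \<in> carrier G" "x \<in> carrier G"
  shows "g \<otimes> (k \<otimes> x \<otimes> inv k) \<otimes> inv g = (g \<otimes> k) \<otimes> x \<otimes> inv (g \<otimes> k)"
  using assms by (simp add: m_assoc inv_mult_group)
lemma (in normal) conjugation_hom:
  assumes g: "g \<in> carrier G"
  shows "(\<lambda>x. g \<otimes> x \<otimes> inv g) \<in> hom (G\<lparr>carrier := H\<rparr>) (G\<lparr>carrier := H\<rparr>)"
  using group_hom.homh[OF conjugation_group_hom[OF g]] inv_op_closed2[OF g]
  by (auto simp: hom_def)

text \<open>
  The averaging trick behind the existence of complements. Choose a section \<open>t\<close> of \<open>h\<close>. The kernel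
  elements \<open>n(g, y) = g t(y) t(h(g) y)\<^sup>-\<^sup>1\<close> measure how far \<open>t\<close> is from being equivariant, and their
  product over all \<open>y\<close> is a crossed homomorphism; on the kernel \<open>n(x, y) = x\<close>, whence the power map.
\<close>

lemma (in group_hom) averaged_crossed_hom:
  assumes surj: "h ` carrier G = carrier H" and fin: "finite (carrier H)"
    and comm: "comm_group (G\<lparr>carrier := kernel G H h\<rparr>)"
  obtains \<psi> where "\<psi> \<in> carrier G \<rightarrow> kernel G H h"
    "\<And>g k. g \<in> carrier G \<Longrightarrow> k \<in> carrier G \<Longrightarrow> \<psi> (g \<otimes> k) = \<psi> g \<otimes> (g \<otimes> \<psi> k \<otimes> inv g)"
    "\<And>n. n \<in> kernel G H h \<Longrightarrow> \<psi> n = n [^] order H"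
proof -
  let ?N = "kernel G H h"
  interpret A: comm_group "G\<lparr>carrier := ?N\<rparr>" by fact
  have N: "?N \<lhd> G" by (rule normal_kernel)
  define t where "t y = (SOME x. x \<in> carrier G \<and> h x = y)" for y
  have t: "t y \<in> carrier G \<and> h (t y) = y" if "y \<in> carrier H" for y
  proof -
    have "\<exists>x. x \<in> carrier G \<and> h x = y" using that surj by (metis imageE)
    then show ?thesis unfolding t_def by (rule someI_ex)
  qed
  define n where "n g y = g \<otimes> t y \<otimes> inv (t (h g \<otimes>\<^bsub>H\<^esub> y))" for g y
  have n_in: "n g y \<in> ?N" if "g \<in> carrier G" "y \<in> carrier H" for g y
    using that t[of y] t[of "h g \<otimes>\<^bsub>H\<^esub> y"] by (simp add: n_def kernel_def)
  define \<psi> where "\<psi> g = finprod (G\<lparr>carrier := ?N\<rparr>) (n g) (carrier H)" for g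
  have nPi: "n g \<in> carrier H \<rightarrow> carrier (G\<lparr>carrier := ?N\<rparr>)" if "g \<in> carrier G" for g
    using n_in that by auto
  have \<psi>N: "\<psi> g \<in> ?N" if "g \<in> carrier G" for g
    using A.finprod_closed[OF nPi[OF that]] by (simp add: \<psi>_def)
  have comm_N: "x \<otimes> y = y \<otimes> x" if "x \<in> ?N" "y \<in> ?N" for x y
    using A.m_comm[simplified, OF that] .
  note conj_hom = normal.conjugation_hom[OF N]
  have n_mult: "n (g \<otimes> k) y = n g (h k \<otimes>\<^bsub>H\<^esub> y) \<otimes> (g \<otimes> n k y \<otimes> inv g)"
    if g: "g \<in> carrier G" and k: "k \<in> carrier G" and y: "y \<in> carrier H" for g k y
  proof -
    have hk: "h k \<otimes>\<^bsub>H\<^esub> y \<in> carrier H" using k y by simp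
    let ?a = "t y" and ?b = "t (h k \<otimes>\<^bsub>H\<^esub> y)" and ?c = "t (h g \<otimes>\<^bsub>H\<^esub> (h k \<otimes>\<^bsub>H\<^esub> y))"
    have abc: "?a \<in> carrier G" "?b \<in> carrier G" "?c \<in> carrier G"
      using t y hk g by auto
    have "(g \<otimes> n k y \<otimes> inv g) \<otimes> n g (h k \<otimes>\<^bsub>H\<^esub> y)
        = g \<otimes> k \<otimes> ?a \<otimes> (inv ?b \<otimes> (inv g \<otimes> g) \<otimes> ?b) \<otimes> inv ?c"
      unfolding n_def using abc g k by (simp only: G.m_assoc G.m_closed G.inv_closed)
    also have "\<dots> = n (g \<otimes> k) y"
      unfolding n_def using abc g k y by (simp add: H.m_assoc)
    finally show ?thesis
      using comm_N[OF normal.inv_op_closed2[OF N g n_in[OF k y]] n_in[OF g hk]] by argo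
  qed
  show ?thesis
  proof (rule that)
    show "\<psi> \<in> carrier G \<rightarrow> ?N" using \<psi>N by auto
    fix g k assume g: "g \<in> carrier G" and k: "k \<in> carrier G"
    let ?A = "G\<lparr>carrier := ?N\<rparr>"
    have hk: "h k \<in> carrier H" using k by simp
    have Pi1: "(\<lambda>y. n g (h k \<otimes>\<^bsub>H\<^esub> y)) \<in> carrier H \<rightarrow> carrier ?A"
      using n_in[OF g] hk by auto
    have Pi2: "(\<lambda>y. g \<otimes> n k y \<otimes> inv g) \<in> carrier H \<rightarrow> carrier ?A"
      using normal.inv_op_closed2[OF N g n_in[OF k]] by auto
    have "\<psi> (g \<otimes> k) = finprod ?A (\<lambda>y. n g (h k \<otimes>\<^bsub>H\<^esub> y) \<otimes>\<^bsub>?A\<^esub> (g \<otimes> n k y \<otimes> inv g)) (carrier H)"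
      unfolding \<psi>_def
    proof (rule A.finprod_cong')
      show "(\<lambda>y. n g (h k \<otimes>\<^bsub>H\<^esub> y) \<otimes>\<^bsub>?A\<^esub> (g \<otimes> n k y \<otimes> inv g)) \<in> carrier H \<rightarrow> carrier ?A"
        using A.m_closed funcset_mem[OF Pi1] funcset_mem[OF Pi2] by blast
    qed (simp_all add: n_mult[OF g k])
    also have "\<dots> = finprod ?A (\<lambda>y. n g (h k \<otimes>\<^bsub>H\<^esub> y)) (carrier H)
        \<otimes>\<^bsub>?A\<^esub> finprod ?A (\<lambda>y. g \<otimes> n k y \<otimes> inv g) (carrier H)"
      using Pi1 Pi2 by (intro A.finprod_multf)
    also have "finprod ?A (\<lambda>y. n g (h k \<otimes>\<^bsub>H\<^esub> y)) (carrier H) =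
        finprod ?A (n g) ((\<lambda>y. h k \<otimes>\<^bsub>H\<^esub> y) ` carrier H)"
      using nPi[OF g] hk by (intro A.finprod_reindex[symmetric] H.inj_on_cmult) auto
    also have "\<dots> = \<psi> g" unfolding \<psi>_def using H.surj_const_mult[OF hk] by simp
    also have "finprod ?A (\<lambda>y. g \<otimes> n k y \<otimes> inv g) (carrier H) = g \<otimes> \<psi> k \<otimes> inv g"
      unfolding \<psi>_def using A.finprod_endomorphism[OF conj_hom[OF g] fin nPi[OF k]] by simp
    finally show "\<psi> (g \<otimes> k) = \<psi> g \<otimes> (g \<otimes> \<psi> k \<otimes> inv g)" by simp
  next
    fix x assume x: "x \<in> ?N"
    then have xG: "x \<in> carrier G" "h x = \<one>\<^bsub>H\<^esub>" by (auto simp: kernel_def)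
    have "n x y = x" if "y \<in> carrier H" for y
      unfolding n_def using t[OF that] xG that by (simp add: G.m_assoc)
    then have "\<psi> x = finprod (G\<lparr>carrier := ?N\<rparr>) (\<lambda>_. x) (carrier H)"
      unfolding \<psi>_def using x by (intro A.finprod_cong') auto
    also have "\<dots> = x [^] order H"
      using A.finprod_const[of x "carrier H"] x
      by (simp add: order_def flip: G.nat_pow_consistent)
    finally show "\<psi> x = x [^] order H" .
  qed
qed

section \<open>Hall's theorem for finite solvable groups\<close>

definition hall_subgroup :: "nat set \<Rightarrow> 'a set \<Rightarrow> ('a, 'm) monoid_scheme \<Rightarrow> bool" where
  "hall_subgroup \<sigma> S G \<longleftrightarrow> subgroup S G \<and> prime_support_in \<sigma> (card S)
     \<and> prime_support_in (- \<sigma>) (order G div card S)"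

text \<open>
  Existence and dominance are bundled, because lifting from a quotient needs dominance there: it is what
  moves the \<open>\<sigma>\<close>-subgroups of the group into the preimage of the Hall subgroup of the quotient.
\<close>

definition hall_theorem_holds :: "nat set \<Rightarrow> ('a, 'm) monoid_scheme \<Rightarrow> bool" where
  "hall_theorem_holds \<sigma> G \<longleftrightarrow> (\<exists>S. hall_subgroup \<sigma> S G \<and>
     (\<forall>U. subgroup U G \<longrightarrow> prime_support_in \<sigma> (card U) \<longrightarrow>
       (\<exists>g\<in>carrier G. \<forall>u\<in>U. g \<otimes>\<^bsub>G\<^esub> u \<otimes>\<^bsub>G\<^esub> inv\<^bsub>G\<^esub> g \<in> S)))"

text \<open>
  A crossed homomorphism that retracts \<open>G\<close> onto \<open>I\<close> exhibits its zero set \<open>K\<close> as a complement of \<open>I\<close>: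
  each \<open>g\<close> is uniquely the product of \<open>f(g) \<in> I\<close> and an element of \<open>K\<close>.
\<close>

lemma (in group) crossed_hom_zero_set_complement:
  assumes norm: "N \<lhd> G" and I: "I \<subseteq> N"
    and comm: "\<And>x y. x \<in> N \<Longrightarrow> y \<in> N \<Longrightarrow> x \<otimes> y = y \<otimes> x"
    and f: "f \<in> carrier G \<rightarrow> I"
    and cross: "\<And>g k. g \<in> carrier G \<Longrightarrow> k \<in> carrier G \<Longrightarrow> f (g \<otimes> k) = f g \<otimes> (g \<otimes> f k \<otimes> inv g)"
    and onI: "\<And>n. n \<in> I \<Longrightarrow> f n = n"
  defines "K \<equiv> {g \<in> carrier G. f g = \<one>}"
  shows "subgroup K G" and "card K * card I = order G"
proof -
  interpret N: normal N G by fact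
  have fN: "f g \<in> N" "f g \<in> carrier G" if "g \<in> carrier G" for g
    using that f I N.subset by auto
  have f1: "f \<one> = \<one>"
    using cross[of \<one> \<one>] fN(2)[OF one_closed] by simp
  show subK: "subgroup K G"
  proof (rule subgroupI)
    show "K \<subseteq> carrier G" by (auto simp: K_def)
    show "K \<noteq> {}" using f1 by (auto simp: K_def)
    fix a assume a: "a \<in> K"
    then have aG: "a \<in> carrier G" "f a = \<one>" by (auto simp: K_def)
    have "\<one> = a \<otimes> f (inv a) \<otimes> inv a"
      using cross[of a "inv a"] aG fN f1 by simp
    then have "f (inv a) = \<one>"
      using aG fN(2)[of "inv a"] by (metis inv_closed inv_solve_right' l_cancel_one m_closed one_closed l_one)
    then show "inv a \<in> K" using aG by (simp add: K_def)
    fix b assume b: "b \<in> K"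
    then have bG: "b \<in> carrier G" "f b = \<one>" by (auto simp: K_def)
    show "a \<otimes> b \<in> K" using cross[of a b] aG bG by (simp add: K_def)
  qed
  have IG: "I \<subseteq> carrier G" using I N.subset by auto
  have "bij_betw (\<lambda>(n, k). n \<otimes> k) (I \<times> K) (carrier G)"
  proof (rule bij_betwI)
    show "(\<lambda>(n, k). n \<otimes> k) \<in> I \<times> K \<rightarrow> carrier G"
      using IG by (auto simp: K_def)
    show "(\<lambda>g. (f g, inv (f g) \<otimes> g)) \<in> carrier G \<rightarrow> I \<times> K"
    proof
      fix g assume g: "g \<in> carrier G"
      have fgI: "f g \<in> I" using f g by auto
      have fg: "f g \<in> carrier G" using fN g by auto
      have "f (f g \<otimes> (inv (f g) \<otimes> g)) = f g \<otimes> (f g \<otimes> f (inv (f g) \<otimes> g) \<otimes> inv (f g))"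
        using cross[of "f g" "inv (f g) \<otimes> g"] onI[OF fgI] fg g by simp
      also have "f g \<otimes> (inv (f g) \<otimes> g) = g" using fg g by (simp add: m_assoc[symmetric])
      also have "f g \<otimes> f (inv (f g) \<otimes> g) \<otimes> inv (f g) = f (inv (f g) \<otimes> g)"
        using comm[OF fN(1) fN(1), of g "inv (f g) \<otimes> g"] fN(2)[of "inv (f g) \<otimes> g"] fg g
        by (metis inv_closed inv_solve_right' m_closed)
      finally have "f (inv (f g) \<otimes> g) = \<one>"
        using l_cancel_one'[OF fg fN(2)[OF m_closed[OF inv_closed[OF fg] g]]] by blast
      then show "(f g, inv (f g) \<otimes> g) \<in> I \<times> K"
        using fgI fg g by (simp add: K_def)
    qed
    fix g assume g: "g \<in> carrier G"
    show "(case (f g, inv (f g) \<otimes> g) of (n, k) \<Rightarrow> n \<otimes> k) = g"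
      using fN[OF g] g by (simp add: m_assoc[symmetric])
  next
    fix p assume "p \<in> I \<times> K"
    then obtain n k where p: "p = (n, k)" "n \<in> I" "k \<in> carrier G" "f k = \<one>" by (auto simp: K_def)
    have n: "n \<in> carrier G" using p IG by auto
    have "f (n \<otimes> k) = n" using cross[OF n p(3)] p n onI by simp
    then show "(f (case p of (n, k) \<Rightarrow> n \<otimes> k), inv (f (case p of (n, k) \<Rightarrow> n \<otimes> k)) \<otimes> (case p of (n, k) \<Rightarrow> n \<otimes> k)) = p"
      using p n by (simp add: m_assoc[symmetric])
  qed
  from bij_betw_same_card[OF this] show "card K * card I = order G"
    by (simp add: order_def card_cartesian_product mult.commute)
qed

lemma kernel_restrict:
  "K \<subseteq> carrier G \<Longrightarrow> kernel (G\<lparr>carrier := K\<rparr>) H h = K \<inter> kernel G H h"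
  by (auto simp: kernel_def)

text \<open>
  The heart of Hall's theorem: an abelian kernel \<open>N\<close> under a quotient \<open>H\<close> whose order has all its primes in
  \<open>\<sigma>\<close>. Let \<open>|N| = a b\<close> with \<open>a\<close> supported in \<open>\<sigma>\<close> and \<open>b\<close> prime to \<open>\<sigma>\<close>. The averaged crossed
  homomorphism is \<open>x \<mapsto> x\<^sup>|\<^sup>H\<^sup>|\<close> on \<open>N\<close>; raising it to the power \<open>a t\<close> with \<open>|H| a t \<equiv> 1\<close> modulo
  \<open>b\<close> turns it into a retraction \<open>f\<close> of \<open>G\<close> onto the \<open>b\<close>-torsion \<open>I\<close> of \<open>N\<close>. Its zero set is the Hall
  subgroup. On a \<open>\<sigma>\<close>-subgroup \<open>U\<close> the map \<open>f\<close> is a coboundary, given by some \<open>q \<in> I\<close>, and conjugation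
  by \<open>q\<^sup>-\<^sup>1\<close> moves \<open>U\<close> into the zero set.
\<close>

lemma (in group_hom) hall_theorem_if_image_supported:
  assumes surj: "h ` carrier G = carrier H" and fin: "finite (carrier G)"
    and comm: "comm_group (G\<lparr>carrier := kernel G H h\<rparr>)"
    and supp: "prime_support_in \<sigma> (order H)"
  shows "hall_theorem_holds \<sigma> G"
proof -
  let ?N = "kernel G H h"
  let ?A = "G\<lparr>carrier := ?N\<rparr>"
  interpret A: comm_group ?A by fact
  have N: "?N \<lhd> G" by (rule normal_kernel)
  interpret N: normal ?N G by fact
  have finN: "finite ?N" using fin finite_subset[OF N.subset] by blast
  have finH: "finite (carrier H)" using surj fin by (metis finite_imageI)
  have cardN: "card ?N > 0" using N.one_closed finN card_gt_0_iff by blast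
  have powA: "x [^]\<^bsub>?A\<^esub> k = x [^] k" for x and k :: nat
    by (metis G.nat_pow_consistent)
  have NG: "x \<in> carrier G" if "x \<in> ?N" for x using that N.subset by auto
  have comm_N: "x \<otimes> y = y \<otimes> x" if "x \<in> ?N" "y \<in> ?N" for x y
    using A.m_comm[simplified, OF that] .
  have pow_distrib: "(x \<otimes> y) [^] k = x [^] k \<otimes> y [^] k" if "x \<in> ?N" "y \<in> ?N" for x y and k :: nat
    using A.nat_pow_distrib[of x y k] that by (simp add: powA)
  have powN: "x [^] k \<in> ?N" if "x \<in> ?N" for x and k :: nat
    using A.nat_pow_closed[of x k] that by (simp add: powA)
  have pow_cong: "x [^] k = x [^] l" if "x \<in> ?N" "x [^] b = \<one>" "[k = l] (mod b)" for x and k l b :: nat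
    using A.nat_pow_cong[of x b k l] that by (simp add: powA)
  have conjN: "g \<otimes> x \<otimes> inv g \<in> ?N" if "g \<in> carrier G" "x \<in> ?N" for g x
    using N.inv_op_closed2 that by blast
  note conj_hom = N.conjugation_hom
  have conj_pow: "(g \<otimes> x \<otimes> inv g) [^] k = g \<otimes> x [^] k \<otimes> inv g" if g: "g \<in> carrier G" and x: "x \<in> ?N"
    for g x and k :: nat
  proof -
    interpret c: group_hom ?A ?A "\<lambda>x. g \<otimes> x \<otimes> inv g"
      using conj_hom[OF g] A.is_group by (simp add: group_hom_def group_hom_axioms_def)
    show ?thesis using c.hom_nat_pow[of x k] x by (simp add: powA)
  qed
  obtain a b where ab: "card ?N = a * b" "prime_support_in \<sigma> a" "prime_support_in (- \<sigma>) b"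
    using prime_support_split[OF cardN] by blast
  have expN: "x [^] (a * b) = \<one>" if "x \<in> ?N" for x
    using A.pow_order_eq_1[of x] that ab(1) by (simp add: powA order_def)
  obtain \<psi> where \<psi>: "\<psi> \<in> carrier G \<rightarrow> ?N"
    and \<psi>_mult: "\<And>g k. g \<in> carrier G \<Longrightarrow> k \<in> carrier G \<Longrightarrow> \<psi> (g \<otimes> k) = \<psi> g \<otimes> (g \<otimes> \<psi> k \<otimes> inv g)"
    and \<psi>_N: "\<And>n. n \<in> ?N \<Longrightarrow> \<psi> n = n [^] order H"
    using averaged_crossed_hom[OF surj finH comm] by blast
  have "coprime (order H * a) b"
    using prime_support_in_imp_coprime[OF prime_support_in_mult[OF supp ab(2)] ab(3)] .
  then obtain t where t: "[order H * a * t = 1] (mod b)"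
    using cong_solve_coprime_nat by (metis One_nat_def)
  define f where "f g = \<psi> g [^] (a * t)" for g
  define I where "I = {n \<in> ?N. n [^] b = \<one>}"
  have fI: "f g \<in> I" if "g \<in> carrier G" for g
  proof -
    have p: "\<psi> g \<in> ?N" using \<psi> that by auto
    have "f g [^] b = (\<psi> g [^] (a * b)) [^] t"
      unfolding f_def using NG[OF p] by (simp add: G.nat_pow_pow algebra_simps)
    then show ?thesis using expN[OF p] powN[OF p] by (simp add: I_def f_def)
  qed
  have f_mult: "f (g \<otimes> k) = f g \<otimes> (g \<otimes> f k \<otimes> inv g)" if "g \<in> carrier G" "k \<in> carrier G" for g k
  proof -
    have p: "\<psi> g \<in> ?N" "\<psi> k \<in> ?N" using \<psi> that by auto
    show ?thesis
      unfolding f_def \<psi>_mult[OF that]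
      using pow_distrib[OF p(1) conjN[OF that(1) p(2)]] conj_pow[OF that(1) p(2)] by simp
  qed
  have f_I: "f n = n" if "n \<in> I" for n
  proof -
    have n: "n \<in> ?N" "n [^] b = \<one>" using that by (auto simp: I_def)
    have "f n = n [^] (order H * a * t)"
      unfolding f_def using \<psi>_N[OF n(1)] NG[OF n(1)] by (simp add: G.nat_pow_pow mult.assoc)
    then show ?thesis using pow_cong[OF n t] NG[OF n(1)] by simp
  qed
  define K where "K = {g \<in> carrier G. f g = \<one>}"
  have IN: "I \<subseteq> ?N" by (auto simp: I_def)
  have fPi: "f \<in> carrier G \<rightarrow> I" using fI by auto
  note compl = G.crossed_hom_zero_set_complement[OF N IN comm_N fPi f_mult f_I, folded K_def]
  have subI: "subgroup I G"
  proof (rule G.subgroupI)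
    show "I \<subseteq> carrier G" using IN N.subset by auto
    have "\<one> \<in> I" using N.one_closed by (simp add: I_def)
    then show "I \<noteq> {}" by blast
    fix x assume x: "x \<in> I"
    then show "inv x \<in> I" using NG[of x] by (simp add: I_def G.nat_pow_inv)
    fix y assume y: "y \<in> I"
    then show "x \<otimes> y \<in> I" using x pow_distrib[of x y b] by (simp add: I_def)
  qed
  have finI: "finite I" using IN finN finite_subset by blast
  have suppI: "prime_support_in (- \<sigma>) (card I)"
  proof -
    interpret I: group "G\<lparr>carrier := I\<rparr>" using subgroup.subgroup_is_group[OF subI] by simp
    have "p dvd b" if "prime p" "p dvd card I" for p
    proof (rule I.prime_dvd_exponent[OF _ that(1)])
      show "x [^]\<^bsub>G\<lparr>carrier := I\<rparr>\<^esub> b = \<one>\<^bsub>G\<lparr>carrier := I\<rparr>\<^esub>" if "x \<in> carrier (G\<lparr>carrier := I\<rparr>)" for x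
      proof -
        have "x [^] b = \<one>" using that by (simp add: I_def)
        then show ?thesis by simp (metis G.nat_pow_consistent)
      qed
    qed (use finI that in \<open>auto simp: order_def\<close>)
    then show ?thesis using ab(3) by (auto simp: prime_support_in_def)
  qed
  have finK: "finite K" using fin by (simp add: K_def)
  have suppK: "prime_support_in \<sigma> (card K)"
  proof -
    (* K is an extension of its image in H by K \<inter> N, and on K \<inter> N the map f is the power
       map with exponent |H| a t. So a prime dividing the order of this intersection divides
       |H| a t as well as a b; as t is prime to b, it divides |H| or a. *)
    let ?J = "K \<inter> ?N"
    have subJ: "subgroup ?J G" using G.subgroups_Inter_pair[OF compl(1) N.subgroup_axioms] .
    interpret K: group "G\<lparr>carrier := K\<rparr>" using subgroup.subgroup_is_group[OF compl(1)] by simp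
    interpret J: group "G\<lparr>carrier := ?J\<rparr>" using subgroup.subgroup_is_group[OF subJ] by simp
    interpret hK: group_hom "G\<lparr>carrier := K\<rparr>" H h
      using compl(1) by (unfold_locales) (auto simp: hom_def K_def)
    have "kernel (G\<lparr>carrier := K\<rparr>) H h = ?J"
      by (rule kernel_restrict) (rule subgroup.subset[OF compl(1)])
    then have "card (h ` K) * card ?J = card K"
      using hK.card_image_times_card_kernel finK by (simp add: order_def)
    moreover have "card (h ` K) dvd order H"
      using H.card_subgroup_dvd_order[OF subgroup_img_is_subgroup[OF compl(1)]] .
    moreover have "prime_support_in \<sigma> (card ?J)"
    proof -
      have "p dvd order H * a * t" if "prime p" "p dvd card ?J" for p
      proof (rule J.prime_dvd_exponent[OF _ that(1)])
        show "x [^]\<^bsub>G\<lparr>carrier := ?J\<rparr>\<^esub> (order H * a * t) = \<one>\<^bsub>G\<lparr>carrier := ?J\<rparr>\<^esub>"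
          if "x \<in> carrier (G\<lparr>carrier := ?J\<rparr>)" for x
        proof -
          have x: "x \<in> ?N" "f x = \<one>" using that by (auto simp: K_def)
          have "x [^] (order H * a * t) = \<one>"
            using x \<psi>_N[OF x(1)] NG[OF x(1)] by (simp add: f_def G.nat_pow_pow mult.assoc)
          then show ?thesis by simp (metis G.nat_pow_consistent)
        qed
      qed (use finK that in \<open>auto simp: order_def\<close>)
      moreover have "p dvd a * b" if "prime p" "p dvd card ?J" for p
      proof -
        have "subgroup ?J ?A" by (rule G.subgroup_incl[OF subJ N.subgroup_axioms Int_lower2])
        then have "card ?J dvd order ?A" by (rule A.card_subgroup_dvd_order)
        then show ?thesis using that(2) ab(1) unfolding order_def by (simp add: dvd_trans)
      qed
      moreover have "p \<in> \<sigma>" if "prime p" "p dvd order H * a * t" "p dvd a * b" for p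
      proof -
        have "\<not> (p dvd t \<and> p dvd b)"
        proof
          assume "p dvd t \<and> p dvd b"
          then have "p dvd order H * a * t" "[order H * a * t = 1] (mod p)"
            using t cong_dvd_modulus_nat by auto
          then have "p dvd 1" using cong_dvd_iff by blast
          then show False using that(1) by simp
        qed
        then have "p dvd order H \<or> p dvd a"
          using that by (auto simp: prime_dvd_mult_iff)
        then show ?thesis using supp ab(2) that(1) by (auto simp: prime_support_in_def)
      qed
      ultimately show ?thesis unfolding prime_support_in_def by blast
    qed
    ultimately show ?thesis using prime_support_in_mult prime_support_in_dvd[OF supp] by metis
  qed
  have idx: "order G div card K = card I"
    using compl(2) subgroup.one_closed[OF compl(1)] finK by (metis card_gt_0_iff empty_iff nonzero_mult_div_cancel_left less_numeral_extra(3))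
  have "hall_subgroup \<sigma> K G" using compl(1) suppK suppI idx by (simp add: hall_subgroup_def)
  moreover have "\<exists>g\<in>carrier G. \<forall>u\<in>U. g \<otimes> u \<otimes> inv g \<in> K"
    if U: "subgroup U G" and suppU: "prime_support_in \<sigma> (card U)" for U
  proof -
    let ?U = "G\<lparr>carrier := U\<rparr>"
    have UG: "u \<in> carrier G" if "u \<in> U" for u using U that by (rule subgroup.mem_carrier)
    have grU: "group ?U" using subgroup.subgroup_is_group[OF U] by simp
    have finU: "finite (carrier ?U)" using finite_subset[OF subgroup.subset[OF U] fin] by simp
    obtain q where q: "q \<in> carrier ?A" "q [^]\<^bsub>?A\<^esub> b = \<one>\<^bsub>?A\<^esub>"
      "\<And>u. u \<in> carrier ?U \<Longrightarrow> f u \<otimes>\<^bsub>?A\<^esub> (u \<otimes> q \<otimes> inv u) = q"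
    proof (rule A.coprime_crossed_hom_is_coboundary[OF grU finU, where f = f and b = b and act = "\<lambda>u x. u \<otimes> x \<otimes> inv u"])
      show "coprime (order ?U) b"
        using prime_support_in_imp_coprime[OF suppU ab(3)] by (simp add: order_def)
      show "f \<in> carrier ?U \<rightarrow> carrier ?A" using fI IN UG by auto
      show "f u [^]\<^bsub>?A\<^esub> b = \<one>\<^bsub>?A\<^esub>" if "u \<in> carrier ?U" for u
        using fI[of u] UG that by (simp add: powA I_def)
    qed (use UG conj_hom f_mult in auto)
    have qI: "q \<in> I" using q by (simp add: I_def powA)
    have qG: "q \<in> carrier G" using q(1) NG by simp
    have iqI: "inv q \<in> I" using subgroup.m_inv_closed[OF subI qI] .
    have "inv q \<otimes> u \<otimes> inv (inv q) \<in> K" if u: "u \<in> U" for u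
    proof -
      have "f (u \<otimes> q) = q" using f_mult[of u q] UG[OF u] qG q(3)[of u] u f_I[OF qI] by simp
      then have "f (inv q \<otimes> (u \<otimes> q)) = inv q \<otimes> (inv q \<otimes> q \<otimes> inv (inv q))"
        using f_mult[of "inv q" "u \<otimes> q"] UG[OF u] qG f_I[OF iqI] by simp
      also have "\<dots> = \<one>" using qG by simp
      finally show ?thesis using UG[OF u] qG by (simp add: K_def G.m_assoc)
    qed
    then show ?thesis using qG by blast
  qed
  ultimately show ?thesis unfolding hall_theorem_holds_def by blast
qed

lemma (in group_hom) subgroup_preimage:
  assumes "subgroup S H"
  shows "subgroup {g \<in> carrier G. h g \<in> S} G"
  by (rule G.subgroupI)
    (use subgroup.one_closed[OF assms] subgroup.m_inv_closed[OF assms] subgroup.m_closed[OF assms]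
     in auto)

text \<open>
  A Hall subgroup \<open>T\<close> of the image has a preimage \<open>P\<close> into which every \<open>\<sigma>\<close>-subgroup can be conjugated,
  by dominance in the image; the previous case then applies to \<open>P \<rightarrow> T\<close>, which has the same kernel.
\<close>

lemma (in group_hom) hall_theorem_lifts:
  assumes surj: "h ` carrier G = carrier H" and fin: "finite (carrier G)"
    and comm: "comm_group (G\<lparr>carrier := kernel G H h\<rparr>)"
    and HH: "hall_theorem_holds \<sigma> H"
  shows "hall_theorem_holds \<sigma> G"
proof -
  obtain T where T: "hall_subgroup \<sigma> T H"
    and conjT: "\<And>V. subgroup V H \<Longrightarrow> prime_support_in \<sigma> (card V) \<Longrightarrow>
       \<exists>g\<in>carrier H. \<forall>u\<in>V. g \<otimes>\<^bsub>H\<^esub> u \<otimes>\<^bsub>H\<^esub> inv\<^bsub>H\<^esub> g \<in> T"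
    using HH unfolding hall_theorem_holds_def by blast
  have subT: "subgroup T H" and suppT: "prime_support_in \<sigma> (card T)"
    and idxT: "prime_support_in (- \<sigma>) (order H div card T)"
    using T by (auto simp: hall_subgroup_def)
  define P where "P = {g \<in> carrier G. h g \<in> T}"
  have subP: "subgroup P G" unfolding P_def using subgroup_preimage[OF subT] .
  let ?GP = "G\<lparr>carrier := P\<rparr>" and ?HT = "H\<lparr>carrier := T\<rparr>"
  have PG: "x \<in> carrier G" if "x \<in> P" for x using that by (simp add: P_def)
  interpret P: group ?GP using subgroup.subgroup_is_group[OF subP] by simp
  interpret T: group ?HT using subgroup.subgroup_is_group[OF subT] by simp
  interpret hP: group_hom ?GP ?HT h
    by unfold_locales (auto simp: hom_def P_def)
  have finP: "finite P" using fin by (simp add: P_def)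
  have imgP: "h ` P = T"
  proof
    show "h ` P \<subseteq> T" by (auto simp: P_def)
    show "T \<subseteq> h ` P"
    proof
      fix y assume y: "y \<in> T"
      then have "y \<in> h ` carrier G" using surj subgroup.subset[OF subT] by blast
      then show "y \<in> h ` P" using y by (auto simp: P_def)
    qed
  qed
  have ker: "kernel ?GP ?HT h = kernel G H h"
    using subgroup.one_closed[OF subT] by (auto simp: kernel_def P_def)
  have "hall_theorem_holds \<sigma> ?GP"
    by (rule hP.hall_theorem_if_image_supported) (use imgP finP ker comm suppT in \<open>simp_all add: order_def\<close>)
  then obtain S where S: "hall_subgroup \<sigma> S ?GP"
    and conjS: "\<And>U. subgroup U ?GP \<Longrightarrow> prime_support_in \<sigma> (card U) \<Longrightarrow>
       \<exists>g\<in>carrier ?GP. \<forall>u\<in>U. g \<otimes>\<^bsub>?GP\<^esub> u \<otimes>\<^bsub>?GP\<^esub> inv\<^bsub>?GP\<^esub> g \<in> S"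
    unfolding hall_theorem_holds_def by blast
  have subS': "subgroup S ?GP" and suppS: "prime_support_in \<sigma> (card S)"
    and idxS: "prime_support_in (- \<sigma>) (card P div card S)"
    using S by (auto simp: hall_subgroup_def order_def)
  have subS: "subgroup S G" using G.incl_subgroup[OF subP subS'] .
  have finT: "finite T" using imgP finP by blast
  have "order G div card S = (card P div card S) * (order H div card T)"
  proof -
    have "card P = card T * card (kernel G H h)"
      using hP.card_image_times_card_kernel finP imgP ker by (simp add: order_def)
    moreover have "order G = order H * card (kernel G H h)"
      using card_image_times_card_kernel[OF fin] surj by (simp add: order_def)
    moreover have "card T dvd order H" using H.card_subgroup_dvd_order[OF subT] .
    then obtain r where r: "order H = card T * r" by auto
    moreover have "card S dvd order ?GP" using P.card_subgroup_dvd_order[OF subS'] .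
    then obtain s where s: "card P = card S * s" by (auto simp: order_def)
    ultimately have "order G = card S * (s * r)" by (simp add: ac_simps)
    moreover have "card S > 0"
      using subgroup.one_closed[OF subS] finite_subset[OF subgroup.subset[OF subS] fin] card_gt_0_iff by blast
    moreover have "card T > 0"
      using subgroup.one_closed[OF subT] finT card_gt_0_iff by blast
    ultimately show ?thesis using r s by simp
  qed
  then have "hall_subgroup \<sigma> S G"
    using subS suppS prime_support_in_mult[OF idxS idxT] by (simp add: hall_subgroup_def)
  moreover have "\<exists>g\<in>carrier G. \<forall>u\<in>U. g \<otimes> u \<otimes> inv g \<in> S"
    if U: "subgroup U G" and suppU: "prime_support_in \<sigma> (card U)" for U
  proof -
    have UG: "u \<in> carrier G" if "u \<in> U" for u using U that by (rule subgroup.mem_carrier)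
    have finU: "finite U" using finite_subset[OF subgroup.subset[OF U] fin] .
    have "prime_support_in \<sigma> (card (h ` U))"
      using prime_support_in_dvd[OF suppU card_image_dvd_card[OF U finU]] .
    then obtain y where y: "y \<in> carrier H" "\<And>u. u \<in> U \<Longrightarrow> y \<otimes>\<^bsub>H\<^esub> h u \<otimes>\<^bsub>H\<^esub> inv\<^bsub>H\<^esub> y \<in> T"
      using conjT[OF subgroup_img_is_subgroup[OF U]] by blast
    then obtain g where g: "g \<in> carrier G" "h g = y" using surj by (metis imageE)
    define c where "c x = g \<otimes> x \<otimes> inv g" for x
    have cinj: "inj_on c U"
      using g(1) UG by (simp add: inj_on_def c_def)
    interpret c: group_hom G G c
      using G.conjugation_group_hom[OF g(1)] by (simp add: c_def[abs_def])
    have cU: "c ` U \<subseteq> P"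
      using y(2) g UG by (auto simp: P_def c_def)
    have "subgroup (c ` U) ?GP"
      using G.subgroup_incl[OF c.subgroup_img_is_subgroup[OF U] subP cU] .
    moreover have "prime_support_in \<sigma> (card (c ` U))" using card_image[OF cinj] suppU by simp
    ultimately obtain k where k: "k \<in> P" "\<And>u. u \<in> U \<Longrightarrow> k \<otimes> c u \<otimes> inv k \<in> S"
      using conjS[of "c ` U"] G.m_inv_consistent[OF subP] by auto
    have "(k \<otimes> g) \<otimes> u \<otimes> inv (k \<otimes> g) \<in> S" if u: "u \<in> U" for u
      using k(2)[OF u] PG[OF k(1)] g UG[OF u] by (simp add: c_def G.m_assoc G.inv_mult_group)
    then show ?thesis using PG[OF k(1)] g by blast
  qed
  ultimately show ?thesis unfolding hall_theorem_holds_def by blast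
qed

lemma (in group) derived_series_normal: "(derived G ^^ n) (carrier G) \<lhd> G"
  by (induction n) (simp_all add: normal_self derived_is_normal)

lemma (in group) comm_group_Mod_if_derived_subset:
  assumes M: "M \<lhd> G" and N: "subgroup N G" and der: "derived G N \<subseteq> M"
  shows "comm_group ((G Mod M)\<lparr>carrier := (\<lambda>x. M #> x) ` N\<rparr>)"
proof -
  interpret M: normal M G by fact
  interpret Q: group "G Mod M" by (rule M.factorgroup_is_group)
  have sub: "subgroup ((\<lambda>x. M #> x) ` N) (G Mod M)"
  proof -
    interpret p: group_hom G "G Mod M" "\<lambda>x. M #> x"
      using M.r_coset_hom_Mod by unfold_locales
    show ?thesis using p.subgroup_img_is_subgroup[OF N] .
  qed
  have NG: "x \<in> carrier G" if "x \<in> N" for x using N that by (rule subgroup.mem_carrier)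
  have comm: "(M #> x) \<otimes>\<^bsub>G Mod M\<^esub> (M #> y) = (M #> y) \<otimes>\<^bsub>G Mod M\<^esub> (M #> x)" if "x \<in> N" "y \<in> N" for x y
  proof -
    let ?k = "x \<otimes> y \<otimes> inv x \<otimes> inv y"
    have k: "?k \<in> M" using der that by (auto simp: derived_def intro!: generate.incl)
    have xy: "x \<in> carrier G" "y \<in> carrier G" using NG that by auto
    have "inv x \<otimes> (inv y \<otimes> (y \<otimes> x)) = \<one>" using xy by (simp add: m_assoc[symmetric])
    then have "x \<otimes> y = ?k \<otimes> (y \<otimes> x)" using xy by (simp add: m_assoc)
    then have "M #> (x \<otimes> y) = (M #> ?k) #> (y \<otimes> x)"
      using xy M.subset by (simp add: coset_mult_assoc)
    also have "M #> ?k = M" using k M.subgroup_axioms xy by (simp add: coset_join2)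
    finally show ?thesis using xy by (simp add: M.rcos_sum)
  qed
  interpret S: group "(G Mod M)\<lparr>carrier := (\<lambda>x. M #> x) ` N\<rparr>"
    using subgroup.subgroup_is_group[OF sub] by simp
  show ?thesis
    by (rule S.group_comm_groupI) (use comm in auto)
qed

text \<open>
  The quotients of \<open>G\<close> by the terms of its derived series form a tower of surjections with abelian
  kernels from \<open>G\<close> down to the trivial group. Climbing this tower, rather than inducting on the group
  order, keeps all groups in the induction quotients of one fixed group.
\<close>

theorem (in group) hall_theorem_solvable:
  assumes fin: "finite (carrier G)" and solv: "solvable G"
  shows "hall_theorem_holds \<sigma> G"
proof -
  define D where "D n = (derived G ^^ n) (carrier G)" for n
  have D0: "D 0 = carrier G" and DS: "D (Suc n) = derived G (D n)" for n by (auto simp: D_def)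
  have Dn: "D n \<lhd> G" for n unfolding D_def by (rule derived_series_normal)
  have main: "hall_theorem_holds \<sigma> (G Mod D n)" for n
  proof (induction n)
    case 0
    interpret Q: group "G Mod D 0" using Dn by (rule normal.factorgroup_is_group)
    have one: "carrier (G Mod D 0) = {\<one>\<^bsub>G Mod D 0\<^esub>}"
      using coset_join2[OF _ subgroup_self] unfolding D0 carrier_FactGroup by auto
    have "hall_subgroup \<sigma> {\<one>\<^bsub>G Mod D 0\<^esub>} (G Mod D 0)"
      using Q.triv_subgroup by (simp add: hall_subgroup_def order_def one prime_support_in_def)
    moreover have "\<one>\<^bsub>G Mod D 0\<^esub> \<otimes>\<^bsub>G Mod D 0\<^esub> u \<otimes>\<^bsub>G Mod D 0\<^esub> inv\<^bsub>G Mod D 0\<^esub> \<one>\<^bsub>G Mod D 0\<^esub> \<in> {\<one>\<^bsub>G Mod D 0\<^esub>}"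
      if "subgroup U (G Mod D 0)" "u \<in> U" for U u
    proof -
      have "u = \<one>\<^bsub>G Mod D 0\<^esub>" using subgroup.mem_carrier[OF that] unfolding one by blast
      then show ?thesis by (simp only: Q.r_inv Q.r_one Q.one_closed singleton_iff)
    qed
    ultimately show ?case unfolding hall_theorem_holds_def using Q.one_closed by blast
  next
    case (Suc n)
    let ?M = "D (Suc n)" and ?N = "D n"
    interpret M: normal ?M G by (rule Dn)
    interpret N: normal ?N G by (rule Dn)
    interpret QM: group "G Mod ?M" by (rule M.factorgroup_is_group)
    interpret QN: group "G Mod ?N" by (rule N.factorgroup_is_group)
    have MN: "?M \<subseteq> ?N" unfolding DS using derived_incl[OF order_refl N.subgroup_axioms] .
    have fac: "?N #> x = ?N #> y" if "x \<in> carrier G" "y \<in> carrier G" "?M #> x = ?M #> y" for x y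
    proof -
      have "x \<in> ?M #> y" using rcos_self[OF that(1) M.subgroup_axioms] that(3) by simp
      then have "x \<in> ?N #> y" using MN by (auto simp: r_coset_def)
      then show ?thesis using repr_independence[OF _ that(2) N.subgroup_axioms] by simp
    qed
    obtain \<pi> where \<pi>: "\<pi> \<in> hom (G Mod ?M) (G Mod ?N)" "\<And>x. x \<in> carrier G \<Longrightarrow> \<pi> (?M #> x) = ?N #> x"
      using FactGroup_universal[OF N.r_coset_hom_Mod Dn fac] by blast
    interpret \<pi>: group_hom "G Mod ?M" "G Mod ?N" \<pi> using \<pi>(1) by unfold_locales
    have surj: "\<pi> ` carrier (G Mod ?M) = carrier (G Mod ?N)"
      unfolding carrier_FactGroup image_image using \<pi>(2) by simp
    have "kernel (G Mod ?M) (G Mod ?N) \<pi> = (\<lambda>x. ?M #> x) ` ?N"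
    proof
      show "kernel (G Mod ?M) (G Mod ?N) \<pi> \<subseteq> (\<lambda>x. ?M #> x) ` ?N"
        using \<pi>(2) coset_join1[OF _ _ N.subgroup_axioms] by (auto simp: kernel_def carrier_FactGroup)
      show "(\<lambda>x. ?M #> x) ` ?N \<subseteq> kernel (G Mod ?M) (G Mod ?N) \<pi>"
        using \<pi>(2) coset_join2[OF _ N.subgroup_axioms] by (auto simp: kernel_def carrier_FactGroup)
    qed
    then have "comm_group ((G Mod ?M)\<lparr>carrier := kernel (G Mod ?M) (G Mod ?N) \<pi>\<rparr>)"
      using comm_group_Mod_if_derived_subset[OF Dn[of "Suc n"] N.subgroup_axioms] DS by simp
    then show ?case
      using \<pi>.hall_theorem_lifts[OF surj _ _ Suc.IH] fin by (simp add: carrier_FactGroup)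
  qed
  obtain n where n: "D n = {\<one>}" using solv solvable_iff_trivial_derived_seq by (auto simp: D_def)
  interpret T: normal "{\<one>}" G by (rule one_is_normal)
  interpret Q: group "G Mod {\<one>}" by (rule T.factorgroup_is_group)
  interpret p: group_hom G "G Mod {\<one>}" "\<lambda>x. {\<one>} #> x" using T.r_coset_hom_Mod by unfold_locales
  have ker: "kernel G (G Mod {\<one>}) (\<lambda>x. {\<one>} #> x) = {\<one>}" by (auto simp: kernel_def r_coset_def)
  interpret K: group "G\<lparr>carrier := {\<one>}\<rparr>" using subgroup.subgroup_is_group[OF triv_subgroup] by simp
  have "comm_group (G\<lparr>carrier := {\<one>}\<rparr>)" by (rule K.group_comm_groupI) auto
  then show ?thesis
    using p.hall_theorem_lifts[of \<sigma>] main[of n] n fin ker by (simp add: carrier_FactGroup)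
qed

section \<open>Skew braces and their ideals\<close>

text \<open>
  The quotient brace and the two factor groups are records of different types with the same carrier and
  the same operations; facts have to be transported between them by their components.
\<close>

lemma group_cong:
  assumes "group G" and c: "carrier G' = carrier G" and m: "monoid.mult G' = monoid.mult G" and o: "one G' = one G"
  shows "group G'"
proof -
  interpret G: group G by fact
  show ?thesis
    by (rule groupI) (simp_all add: c m o G.m_assoc)
qed

context skew_brace
begin

sublocale add: group "add_monoid X"
  rewrites "carrier (add_monoid X) = carrier X"
    and "monoid.mult (add_monoid X) = add X"
    and "one (add_monoid X) = zero X"
    and "m_inv (add_monoid X) = a_inv X"
  by (rule additive_group) (simp_all add: a_inv_def)

sublocale mult: group X
  by (rule multiplicative_group)

lemma add_left_cancel_iff:
  assumes "x \<in> carrier X" "y \<in> carrier X" "z \<in> carrier X"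
  shows "x \<oplus> y = x \<oplus> z \<longleftrightarrow> y = z"
  using add.inj_on_cmult[of x] assms by (meson inj_on_eq_iff)

lemma mult_zero_right:
  assumes "a \<in> carrier X"
  shows "a \<otimes> \<zero> = a"
proof -
  have c: "a \<otimes> \<zero> \<in> carrier X" "\<ominus> a \<in> carrier X" using assms by auto
  have "a \<otimes> \<zero> = a \<otimes> \<zero> \<ominus> a \<oplus> a \<otimes> \<zero>"
    using brace_law[of a \<zero> \<zero>] assms by simp
  then have "a \<otimes> \<zero> \<oplus> \<zero> = a \<otimes> \<zero> \<oplus> (\<ominus> a \<oplus> a \<otimes> \<zero>)"
    using c by (simp add: a_minus_def add.m_assoc)
  then have "\<zero> = \<ominus> a \<oplus> a \<otimes> \<zero>"
    using add_left_cancel_iff c by (metis add.m_closed add.one_closed)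
  then have "a \<oplus> \<zero> = a \<oplus> (\<ominus> a \<oplus> a \<otimes> \<zero>)" by simp
  then show ?thesis using c assms by (simp add: add.m_assoc[symmetric])
qed

lemma zero_eq_one: "\<zero> = \<one>"
  using mult_zero_right[of \<one>] by simp

lemma lambda_closed [simp, intro]:
  "a \<in> carrier X \<Longrightarrow> b \<in> carrier X \<Longrightarrow> brace_lambda X a b \<in> carrier X"
  by (simp add: brace_lambda_def)

lemma mult_eq_add_lambda:
  "a \<in> carrier X \<Longrightarrow> b \<in> carrier X \<Longrightarrow> a \<otimes> b = a \<oplus> brace_lambda X a b"
  by (simp add: brace_lambda_def add.m_assoc[symmetric])

lemma lambda_zero: "a \<in> carrier X \<Longrightarrow> brace_lambda X a \<zero> = \<zero>"
  by (simp add: brace_lambda_def mult_zero_right)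

lemma lambda_add:
  assumes "a \<in> carrier X" "b \<in> carrier X" "c \<in> carrier X"
  shows "brace_lambda X a (b \<oplus> c) = brace_lambda X a b \<oplus> brace_lambda X a c"
  using assms by (simp add: brace_lambda_def brace_law a_minus_def add.m_assoc)

lemma lambda_mult:
  assumes "a \<in> carrier X" "b \<in> carrier X" "c \<in> carrier X"
  shows "brace_lambda X (a \<otimes> b) c = brace_lambda X a (brace_lambda X b c)"
proof -
  have l: "brace_lambda X b c \<in> carrier X" using assms by simp
  have "a \<otimes> b \<otimes> c = a \<otimes> (b \<oplus> brace_lambda X b c)"
    using assms by (simp only: mult.m_assoc mult_eq_add_lambda[OF assms(2,3)])
  also have "\<dots> = a \<otimes> b \<oplus> brace_lambda X a (brace_lambda X b c)"
    using assms l by (simp add: brace_law brace_lambda_def[of X a] a_minus_def add.m_assoc)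
  finally have e: "a \<otimes> b \<otimes> c = a \<otimes> b \<oplus> brace_lambda X a (brace_lambda X b c)" .
  show ?thesis
    unfolding brace_lambda_def[of X "a \<otimes> b"] e
    using assms l by (simp add: add.m_assoc[symmetric])
qed

lemma lambda_one [simp]: "c \<in> carrier X \<Longrightarrow> brace_lambda X \<one> c = c"
  by (simp add: brace_lambda_def flip: zero_eq_one)

lemma lambda_inv_cancel:
  assumes "a \<in> carrier X" "c \<in> carrier X"
  shows "brace_lambda X a (brace_lambda X (inv a) c) = c"
  using lambda_mult[of a "inv a" c] assms by simp

lemma star_closed:
  "a \<in> carrier X \<Longrightarrow> b \<in> carrier X \<Longrightarrow> brace_star X a b \<in> carrier X"
  by (simp add: brace_star_def a_minus_def)

lemma subskew_brace_is_skew_brace: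
  assumes "subskew_brace H X"
  shows "skew_brace (X\<lparr>carrier := H\<rparr>)"
proof -
  have sa: "subgroup H (add_monoid X)" and sm: "subgroup H X"
    using assms by (auto simp: subskew_brace_def)
  have HX: "x \<in> carrier X" if "x \<in> H" for x using subgroup.mem_carrier[OF sm that] .
  show ?thesis
  proof (rule skew_brace.intro)
    show "group (add_monoid (X\<lparr>carrier := H\<rparr>))"
      using subgroup.subgroup_is_group[OF sa additive_group] by simp
    show "group (X\<lparr>carrier := H\<rparr>)"
      using subgroup.subgroup_is_group[OF sm multiplicative_group] .
    fix a b c assume abc: "a \<in> carrier (X\<lparr>carrier := H\<rparr>)" "b \<in> carrier (X\<lparr>carrier := H\<rparr>)" "c \<in> carrier (X\<lparr>carrier := H\<rparr>)"
    have "\<ominus>\<^bsub>X\<lparr>carrier := H\<rparr>\<^esub> a = \<ominus> a"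
      using group.m_inv_consistent[OF additive_group sa, of a] abc by (simp add: a_inv_def)
    then show "a \<otimes>\<^bsub>X\<lparr>carrier := H\<rparr>\<^esub> (b \<oplus>\<^bsub>X\<lparr>carrier := H\<rparr>\<^esub> c) = a \<otimes>\<^bsub>X\<lparr>carrier := H\<rparr>\<^esub> b \<ominus>\<^bsub>X\<lparr>carrier := H\<rparr>\<^esub> a \<oplus>\<^bsub>X\<lparr>carrier := H\<rparr>\<^esub> a \<otimes>\<^bsub>X\<lparr>carrier := H\<rparr>\<^esub> c"
      using brace_law[of a b c] abc HX by (simp add: a_minus_def)
  qed
qed

lemma subskew_brace_operations:
  assumes "subskew_brace H X" "a \<in> H" "b \<in> H"
  shows "brace_lambda (X\<lparr>carrier := H\<rparr>) a b = brace_lambda X a b"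
    and "brace_star (X\<lparr>carrier := H\<rparr>) a b = brace_star X a b"
proof -
  have sa: "subgroup H (add_monoid X)" and sm: "subgroup H X"
    using assms by (auto simp: subskew_brace_def)
  have i: "\<ominus>\<^bsub>X\<lparr>carrier := H\<rparr>\<^esub> x = \<ominus> x" if "x \<in> H" for x
    using group.m_inv_consistent[OF additive_group sa that] by (simp add: a_inv_def)
  show "brace_lambda (X\<lparr>carrier := H\<rparr>) a b = brace_lambda X a b"
    using i[OF assms(2)] by (simp add: brace_lambda_def)
  then show "brace_star (X\<lparr>carrier := H\<rparr>) a b = brace_star X a b"
    using i[OF assms(3)] by (simp add: brace_star_def a_minus_def)
qed

lemma brace_ideal_iff:
  "brace_ideal I X \<longleftrightarrow> subgroup I (add_monoid X) \<and> subgroup I X \<and>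
     (\<forall>a\<in>carrier X. \<forall>b\<in>I. brace_lambda X a b \<in> I \<and> a \<oplus> b \<oplus> (\<ominus> a) \<in> I \<and> a \<otimes> b \<otimes> inv a \<in> I)"
  using group.normal_inv_iff[OF additive_group, of I] group.normal_inv_iff[OF multiplicative_group, of I]
  by (auto simp: brace_ideal_def a_inv_def)

lemma carrier_is_ideal: "brace_ideal (carrier X) X"
  using add.subgroup_self mult.subgroup_self by (simp add: brace_ideal_iff)

lemma Inter_ideals:
  assumes "\<I> \<noteq> {}" "\<And>I. I \<in> \<I> \<Longrightarrow> brace_ideal I X"
  shows "brace_ideal (\<Inter>\<I>) X"
proof -
  have "subgroup (\<Inter>\<I>) (add_monoid X)"
    using group.subgroups_Inter[OF additive_group] assms by (auto simp: brace_ideal_iff)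
  moreover have "subgroup (\<Inter>\<I>) X"
    using mult.subgroups_Inter assms by (auto simp: brace_ideal_iff)
  ultimately show ?thesis using assms(2) by (auto simp: brace_ideal_iff)
qed

text \<open>
  \<open>x \<cdot> i = x + \<lambda>\<^sub>x(i)\<close> and \<open>\<lambda>\<^sub>x\<close> permutes \<open>I\<close>, its inverse being \<open>\<lambda>\<close> at the inverse of \<open>x\<close>. Hence
  the left cosets coincide, and by normality so do the right ones. This makes the quotient by an
  ideal a quotient of both groups at once.
\<close>

lemma ideal_cosets_agree:
  assumes I: "brace_ideal I X" and x: "x \<in> carrier X"
  shows "I #> x = I +> x"
proof -
  have na: "I \<lhd> add_monoid X" and nm: "I \<lhd> X" using I by (auto simp: brace_ideal_def)
  have IX: "i \<in> carrier X" if "i \<in> I" for i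
    using I that subgroup.mem_carrier[of I X] by (auto simp: brace_ideal_iff)
  have lam: "brace_lambda X a i \<in> I" if "a \<in> carrier X" "i \<in> I" for a i
    using I that by (auto simp: brace_ideal_def)
  have "x <# I = x <+ I"
  proof
    show "x <# I \<subseteq> x <+ I"
      using mult_eq_add_lambda[OF x IX] lam[OF x] by (auto simp: l_coset_def a_l_coset_def)
    show "x <+ I \<subseteq> x <# I"
    proof
      fix y assume "y \<in> x <+ I"
      then obtain i where i: "i \<in> I" "y = x \<oplus> i" by (auto simp: l_coset_def a_l_coset_def)
      let ?j = "brace_lambda X (inv x) i"
      have j: "?j \<in> I" using lam[OF _ i(1)] x by simp
      have "x \<otimes> ?j = y" using mult_eq_add_lambda[OF x IX[OF j]] lambda_inv_cancel[OF x IX[OF i(1)]] i by simp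
      then show "y \<in> x <# I" using j by (auto simp: l_coset_def)
    qed
  qed
  then show ?thesis
    using normal.coset_eq[OF na] normal.coset_eq[OF nm] x by (simp add: a_l_coset_def a_r_coset_def)
qed

lemma brace_quotient_simps:
  assumes I: "brace_ideal I X"
  shows "carrier (brace_quotient X I) = (\<lambda>x. I +> x) ` carrier X"
    and "carrier (brace_quotient X I) = carrier (add_monoid X Mod I)"
    and "carrier (brace_quotient X I) = carrier (X Mod I)"
    and "monoid.mult (brace_quotient X I) = monoid.mult (X Mod I)"
    and "add (brace_quotient X I) = monoid.mult (add_monoid X Mod I)"
    and "zero (brace_quotient X I) = I" "one (brace_quotient X I) = I"
proof -
  show c: "carrier (brace_quotient X I) = (\<lambda>x. I +> x) ` carrier X"
    by (auto simp: brace_quotient_def A_RCOSETS_def RCOSETS_def a_r_coset_def)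
  show "carrier (brace_quotient X I) = carrier (add_monoid X Mod I)"
    by (simp add: brace_quotient_def A_RCOSETS_def FactGroup_def)
  show "carrier (brace_quotient X I) = carrier (X Mod I)"
    unfolding c carrier_FactGroup using ideal_cosets_agree[OF I] by auto
qed (auto simp: brace_quotient_def FactGroup_def set_add_def)

lemma brace_quotient_groups:
  assumes I: "brace_ideal I X"
  shows "group (add_monoid (brace_quotient X I))" and "group (brace_quotient X I)"
proof -
  have na: "I \<lhd> add_monoid X" and nm: "I \<lhd> X" using I by (auto simp: brace_ideal_def)
  show "group (add_monoid (brace_quotient X I))"
    by (rule group_cong[OF normal.factorgroup_is_group[OF na]])
      (use brace_quotient_simps[OF I] in \<open>auto simp: FactGroup_def\<close>)
  show "group (brace_quotient X I)"
    by (rule group_cong[OF normal.factorgroup_is_group[OF nm]])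
      (use brace_quotient_simps[OF I] in \<open>auto simp: FactGroup_def\<close>)
qed

lemma brace_quotient_projection:
  assumes I: "brace_ideal I X"
  shows "group_hom (add_monoid X) (add_monoid (brace_quotient X I)) (\<lambda>x. I +> x)"
    and "group_hom X (brace_quotient X I) (\<lambda>x. I +> x)"
proof -
  have na: "I \<lhd> add_monoid X" and nm: "I \<lhd> X" using I by (auto simp: brace_ideal_def)
  note s = brace_quotient_simps[OF I]
  have "(\<lambda>x. I +> x) \<in> hom (add_monoid X) (add_monoid (brace_quotient X I))"
    using normal.r_coset_hom_Mod[OF na] s(2,5) by (simp add: hom_def a_r_coset_def)
  then show "group_hom (add_monoid X) (add_monoid (brace_quotient X I)) (\<lambda>x. I +> x)"
    using additive_group brace_quotient_groups(1)[OF I] by (simp add: group_hom_def group_hom_axioms_def)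
  have "(\<lambda>x. I #> x) \<in> hom X (brace_quotient X I)"
    using normal.r_coset_hom_Mod[OF nm] s(3,4) by (simp add: hom_def)
  then have "(\<lambda>x. I +> x) \<in> hom X (brace_quotient X I)"
    using ideal_cosets_agree[OF I] by (simp add: hom_def Pi_def)
  then show "group_hom X (brace_quotient X I) (\<lambda>x. I +> x)"
    using multiplicative_group brace_quotient_groups(2)[OF I] by (simp add: group_hom_def group_hom_axioms_def)
qed

lemma ideal_coset_eq_iff:
  assumes I: "brace_ideal I X" and x: "x \<in> carrier X"
  shows "I +> x = I \<longleftrightarrow> x \<in> I"
proof -
  have s: "subgroup I (add_monoid X)" using I by (simp add: brace_ideal_def)
  show ?thesis
    unfolding a_r_coset_def
    using group.coset_join1[OF additive_group _ _ s] group.coset_join2[OF additive_group _ s] x by auto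
qed

lemma card_brace_quotient:
  assumes I: "brace_ideal I X" and fin: "finite (carrier X)"
  shows "order (brace_quotient X I) * card I = order X"
proof -
  interpret p: group_hom X "brace_quotient X I" "\<lambda>x. I +> x" by (rule brace_quotient_projection[OF I])
  have "I \<subseteq> carrier X" using I subgroup.subset[of I X] by (simp add: brace_ideal_iff)
  then have "kernel X (brace_quotient X I) (\<lambda>x. I +> x) = I"
    using ideal_coset_eq_iff[OF I] brace_quotient_simps(7)[OF I] by (auto simp: kernel_def)
  then show ?thesis
    using p.card_image_times_card_kernel[OF fin] brace_quotient_simps(1)[OF I] by (simp add: order_def)
qed

section \<open>The left series and its residual\<close>

lemma left_series_carrier: "left_series X n \<subseteq> carrier X"
proof (induction n)
  case (Suc n)
  have "{brace_star X s t |s t. s \<in> carrier X \<and> t \<in> left_series X n} \<subseteq> carrier X"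
    using Suc star_closed by blast
  then show ?case
    using group.generate_incl[OF additive_group, of "{brace_star X s t |s t. s \<in> carrier X \<and> t \<in> left_series X n}"]
    by (simp add: brace_set_star_def)
qed simp

lemma zero_in_left_series: "\<zero> \<in> left_series X n"
proof (cases n)
  case (Suc m)
  then show ?thesis using generate.one[of "add_monoid X"] by (simp add: brace_set_star_def)
qed simp

lemma left_series_surjective_image:
  assumes f_add: "group_hom (add_monoid X) (add_monoid Y) f" and f_mult: "f \<in> hom X Y"
    and surj: "f ` carrier X = carrier Y"
  shows "left_series Y n = f ` left_series X n"
proof (induction n)
  case (Suc n)
  interpret f: group_hom "add_monoid X" "add_monoid Y" f by fact
  have inv: "\<ominus>\<^bsub>Y\<^esub> (f a) = f (\<ominus> a)" if "a \<in> carrier X" for a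
    using f.hom_inv[of a] that by (simp add: a_inv_def)
  have add: "f (a \<oplus> b) = f a \<oplus>\<^bsub>Y\<^esub> f b" if "a \<in> carrier X" "b \<in> carrier X" for a b
    using f.hom_mult[of a b] that by simp
  have star: "brace_star Y (f a) (f b) = f (brace_star X a b)" if "a \<in> carrier X" "b \<in> carrier X" for a b
    using that hom_mult[OF f_mult] by (simp add: brace_star_def brace_lambda_def a_minus_def inv add)
  let ?S = "{brace_star X s t |s t. s \<in> carrier X \<and> t \<in> left_series X n}"
  have S: "?S \<subseteq> carrier X" using left_series_carrier[of n] star_closed by blast
  have "{brace_star Y s t |s t. s \<in> carrier Y \<and> t \<in> left_series Y n} = f ` ?S"
    unfolding Suc.IH surj[symmetric] using star left_series_carrier[of n]
    by (auto simp: image_iff) (metis subsetD)+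
  then show ?case
    using f.generate_img[of ?S] S by (simp add: brace_set_star_def)
qed (simp add: surj)

text \<open>
  The left series of \<open>X/I\<close> is the image of the left series of \<open>X\<close>.
\<close>

lemma left_nilpotent_quotient_iff:
  assumes I: "brace_ideal I X"
  shows "left_nilpotent (brace_quotient X I) \<longleftrightarrow> (\<exists>n. left_series X n \<subseteq> I)"
proof -
  interpret p: group_hom X "brace_quotient X I" "\<lambda>x. I +> x" by (rule brace_quotient_projection[OF I])
  have "left_series (brace_quotient X I) n = {\<zero>\<^bsub>brace_quotient X I\<^esub>} \<longleftrightarrow> left_series X n \<subseteq> I" for n
  proof -
    have "left_series (brace_quotient X I) n = (\<lambda>x. I +> x) ` left_series X n"
      by (rule left_series_surjective_image[OF brace_quotient_projection(1)[OF I] p.homh])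
        (simp add: brace_quotient_simps(1)[OF I])
    moreover have "(\<lambda>x. I +> x) ` left_series X n = {I} \<longleftrightarrow> (\<forall>x\<in>left_series X n. I +> x = I)"
      using zero_in_left_series[of n] by auto
    moreover have "(\<forall>x\<in>left_series X n. I +> x = I) \<longleftrightarrow> left_series X n \<subseteq> I"
      using ideal_coset_eq_iff[OF I] left_series_carrier[of n] by blast
    ultimately show ?thesis using brace_quotient_simps(6)[OF I] by simp
  qed
  then show ?thesis by (simp add: left_nilpotent_def)
qed

lemma left_series_stays_in_ideal:
  assumes I: "brace_ideal I X" and n: "left_series X n \<subseteq> I" and "n \<le> m"
  shows "left_series X m \<subseteq> I"
  using assms(3)
proof (induction m rule: dec_induct)
  case (step m)
  have sa: "subgroup I (add_monoid X)" using I by (simp add: brace_ideal_def)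
  have "brace_star X s t \<in> I" if "s \<in> carrier X" "t \<in> I" for s t
    using I that subgroup.m_closed[OF sa] subgroup.m_inv_closed[OF sa]
    by (simp add: brace_star_def a_minus_def brace_ideal_def a_inv_def)
  then have "{brace_star X s t |s t. s \<in> carrier X \<and> t \<in> left_series X m} \<subseteq> I"
    using step.IH by blast
  then show ?case
    using group.generate_subgroup_incl[OF additive_group _ sa] by (simp add: brace_set_star_def)
qed (rule n)

lemma left_nilpotent_residual_ideal: "brace_ideal (left_nilpotent_residual X) X"
  unfolding left_nilpotent_residual_def
proof (rule Inter_ideals)
  have "left_series X 0 \<subseteq> carrier X" by simp
  then have "left_nilpotent (brace_quotient X (carrier X))"
    using left_nilpotent_quotient_iff[OF carrier_is_ideal] by blast
  then show "{I. brace_ideal I X \<and> left_nilpotent (brace_quotient X I)} \<noteq> {}"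
    using carrier_is_ideal by blast
qed simp

text \<open>
  A finite skew brace has finitely many ideals. Since the left series stays inside an ideal once it
  has entered it, one common index serves all ideals with left nilpotent quotient, and so their
  intersection: the quotient by the residual is itself left nilpotent.
\<close>

lemma left_series_reaches_residual:
  assumes fin: "finite (carrier X)"
  obtains n where "left_series X n \<subseteq> left_nilpotent_residual X"
proof -
  let ?F = "{I. brace_ideal I X \<and> left_nilpotent (brace_quotient X I)}"
  have "?F \<subseteq> Pow (carrier X)"
    using subgroup.subset[of _ X] by (auto simp: brace_ideal_iff)
  then have finF: "finite ?F" using fin finite_subset by blast
  have "\<exists>k. \<forall>I\<in>?F. left_series X (k I) \<subseteq> I"
    using left_nilpotent_quotient_iff by (intro bchoice) auto
  then obtain k where k: "\<And>I. I \<in> ?F \<Longrightarrow> left_series X (k I) \<subseteq> I" by blast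
  have "left_series X (Max (k ` ?F)) \<subseteq> I" if "I \<in> ?F" for I
    using left_series_stays_in_ideal[OF _ k[OF that], of "Max (k ` ?F)"] that finF by auto
  then show ?thesis using that[of "Max (k ` ?F)"] by (auto simp: left_nilpotent_residual_def)
qed

lemma left_series_subskew_brace:
  assumes H: "subskew_brace H X"
  shows "left_series (X\<lparr>carrier := H\<rparr>) n \<subseteq> left_series X n"
proof (induction n)
  case 0
  then show ?case using H subgroup.subset[of H X] by (simp add: subskew_brace_def)
next
  case (Suc n)
  interpret H: skew_brace "X\<lparr>carrier := H\<rparr>" by (rule subskew_brace_is_skew_brace[OF H])
  have sa: "subgroup H (add_monoid X)" and HX: "H \<subseteq> carrier X"
    using H subgroup.subset[of H X] by (auto simp: subskew_brace_def)
  let ?S = "{brace_star (X\<lparr>carrier := H\<rparr>) s t |s t. s \<in> H \<and> t \<in> left_series (X\<lparr>carrier := H\<rparr>) n}"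
  let ?T = "{brace_star X s t |s t. s \<in> carrier X \<and> t \<in> left_series X n}"
  have LH: "left_series (X\<lparr>carrier := H\<rparr>) n \<subseteq> H" using H.left_series_carrier[of n] by simp
  have SH: "?S \<subseteq> H" using LH H.star_closed by auto
  have "?S \<subseteq> ?T" using subskew_brace_operations(2)[OF H] LH HX Suc by blast
  moreover have "generate (add_monoid (X\<lparr>carrier := H\<rparr>)) ?S = generate (add_monoid X) ?S"
    using group.generate_consistent[OF additive_group SH sa] by simp
  ultimately show ?case
    using group.mono_generate[OF additive_group, of ?S ?T] by (simp add: brace_set_star_def)
qed

lemma ideal_Int_subskew_brace:
  assumes H: "subskew_brace H X" and I: "brace_ideal I X"
  shows "brace_ideal (H \<inter> I) (X\<lparr>carrier := H\<rparr>)"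
proof -
  have sa: "subgroup H (add_monoid X)" and sm: "subgroup H X"
    using H by (auto simp: subskew_brace_def)
  have ia: "I \<lhd> add_monoid X" and im: "I \<lhd> X" using I by (auto simp: brace_ideal_def)
  have na: "H \<inter> I \<lhd> add_monoid (X\<lparr>carrier := H\<rparr>)"
    using group.normal_Int_subgroup[OF additive_group sa ia] by (simp add: Int_commute)
  moreover have "H \<inter> I \<lhd> X\<lparr>carrier := H\<rparr>"
    using mult.normal_Int_subgroup[OF sm im] by (simp add: Int_commute)
  moreover have "brace_lambda (X\<lparr>carrier := H\<rparr>) a b \<in> H \<inter> I" if "a \<in> H" "b \<in> H \<inter> I" for a b
  proof -
    interpret H: skew_brace "X\<lparr>carrier := H\<rparr>" by (rule subskew_brace_is_skew_brace[OF H])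
    have "brace_lambda X a b \<in> I"
      using I that subgroup.mem_carrier[OF sm] by (auto simp: brace_ideal_def)
    then show ?thesis
      using H.lambda_closed[of a b] that subskew_brace_operations(1)[OF H, of a b] by auto
  qed
  ultimately show ?thesis using normal_imp_subgroup[OF na] by (auto simp: brace_ideal_def)
qed

end

section \<open>Hall subskew braces and quotients\<close>

lemma iso_cong:
  assumes "carrier G' = carrier G" "monoid.mult G' = monoid.mult G"
  shows "iso G' H = iso G H"
  using assms by (simp add: iso_def hom_def)

context skew_brace
begin

text \<open>
  \<open>H/(H \<inter> R)\<close> is left nilpotent, because the left series of \<open>H\<close> is contained term by term in that of \<open>X\<close>.
\<close>

lemma residual_of_subskew_brace:
  assumes fin: "finite (carrier X)" and H: "subskew_brace H X"
  shows "left_nilpotent_residual (X\<lparr>carrier := H\<rparr>) \<subseteq> H \<inter> left_nilpotent_residual X"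
proof -
  let ?Y = "X\<lparr>carrier := H\<rparr>" and ?R = "left_nilpotent_residual X"
  interpret H: skew_brace ?Y by (rule subskew_brace_is_skew_brace[OF H])
  have id: "brace_ideal (H \<inter> ?R) ?Y"
    by (rule ideal_Int_subskew_brace[OF H left_nilpotent_residual_ideal])
  obtain n where "left_series X n \<subseteq> ?R" using left_series_reaches_residual[OF fin] .
  then have "left_series ?Y n \<subseteq> H \<inter> ?R"
    using left_series_subskew_brace[OF H, of n] H.left_series_carrier[of n] by auto
  then have "left_nilpotent (brace_quotient ?Y (H \<inter> ?R))"
    using H.left_nilpotent_quotient_iff[OF id] by blast
  then show ?thesis using id by (auto simp: left_nilpotent_residual_def[of ?Y])
qed

text \<open>
  A pure counting argument. Projecting \<open>H\<close> to \<open>X/I\<close> gives \<open>|H| = |image| \<cdot> |H \<inter> I|\<close>, where the two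
  factors are at most \<open>|X/I|\<close> and \<open>|I|\<^sub>\<sigma>\<close>. As \<open>\<sigma>\<close> contains all primes dividing \<open>|X/I|\<close>, the order
  \<open>|H| = |X|\<^sub>\<sigma>\<close> is at least the product of these bounds, so both are attained.
\<close>

lemma hall_subskew_brace_supplements_ideal:
  assumes fin: "finite (carrier X)" and I: "brace_ideal I X"
    and H: "hall_subskew_brace \<sigma> H X" and supp: "prime_support_in \<sigma> (order (brace_quotient X I))"
  shows "(\<lambda>x. I +> x) ` H = carrier (brace_quotient X I)"
    and "card (H \<inter> I) = primes_part \<sigma> (card I)"
proof -
  let ?Q = "brace_quotient X I" and ?p = "\<lambda>x. I +> x"
  have sH: "subskew_brace H X" and cH: "card H = primes_part \<sigma> (order X)"
    using H by (auto simp: hall_subskew_brace_def)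
  have sm: "subgroup H X" and im: "subgroup I X"
    using sH I by (auto simp: subskew_brace_def brace_ideal_iff)
  have HX: "H \<subseteq> carrier X" and IX: "I \<subseteq> carrier X"
    using subgroup.subset[OF sm] subgroup.subset[OF im] .
  have finI: "finite I" and finH: "finite H" using IX HX fin finite_subset by auto
  have cI: "card I > 0" using finI subgroup.one_closed[OF im] card_gt_0_iff by blast
  have posX: "order X > 0" using fin mult.order_gt_0_iff_finite by simp
  have cX: "order ?Q * card I = order X" by (rule card_brace_quotient[OF I fin])
  then have cQ: "order ?Q > 0" using posX by (metis gr0I mult_is_0)
  have finQ: "finite (carrier ?Q)" using cQ card.infinite unfolding order_def by fastforce
  interpret p: group_hom X ?Q ?p by (rule brace_quotient_projection(2)[OF I])
  interpret Hg: group "X\<lparr>carrier := H\<rparr>" by (rule subgroup.subgroup_is_group[OF sm multiplicative_group])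
  interpret pH: group_hom "X\<lparr>carrier := H\<rparr>" ?Q ?p
    by unfold_locales (use HX in \<open>auto simp: hom_def intro!: p.hom_closed p.hom_mult\<close>)
  have "kernel (X\<lparr>carrier := H\<rparr>) ?Q ?p = H \<inter> I"
    using ideal_coset_eq_iff[OF I] brace_quotient_simps(7)[OF I] HX by (auto simp: kernel_def)
  then have cH2: "card (?p ` H) * card (H \<inter> I) = card H"
    using pH.card_image_times_card_kernel finH by (simp add: order_def)
  have sub: "?p ` H \<subseteq> carrier ?Q" using HX p.hom_closed by blast
  have "primes_part \<sigma> (card I) * order ?Q \<le> card H"
    unfolding cH cX[symmetric]
  proof (rule primes_part_properties(3))
    show "0 < order ?Q * card I" using cQ cI by simp
    show "primes_part \<sigma> (card I) * order ?Q dvd order ?Q * card I"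
      using primes_part_properties(1)[OF cI] by (simp add: mult.commute mult_dvd_mono)
    show "prime_support_in \<sigma> (primes_part \<sigma> (card I) * order ?Q)"
      using primes_part_properties(2)[OF cI] supp by (rule prime_support_in_mult)
  qed
  moreover have le1: "card (?p ` H) \<le> order ?Q"
    unfolding order_def using sub finQ card_mono by blast
  moreover have le2: "card (H \<inter> I) \<le> primes_part \<sigma> (card I)"
  proof (rule primes_part_properties(3)[OF cI])
    interpret Ig: group "X\<lparr>carrier := I\<rparr>" by (rule subgroup.subgroup_is_group[OF im multiplicative_group])
    have sHI: "subgroup (H \<inter> I) X" by (rule mult.subgroups_Inter_pair[OF sm im])
    show "card (H \<inter> I) dvd card I"
      using Ig.card_subgroup_dvd_order[OF mult.subgroup_incl[OF sHI im]] by (simp add: order_def)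
    have "card (H \<inter> I) dvd card H" using cH2 by (metis dvd_triv_right)
    then show "prime_support_in \<sigma> (card (H \<inter> I))"
      using prime_support_in_dvd primes_part_properties(2)[OF posX] cH by metis
  qed
  moreover have pos: "primes_part \<sigma> (card I) > 0" using cI primes_part_properties(1)[OF cI] dvd_pos_nat by blast
  ultimately have "card (?p ` H) = order ?Q \<and> card (H \<inter> I) = primes_part \<sigma> (card I)"
  proof -
    assume a: "primes_part \<sigma> (card I) * order ?Q \<le> card H"
    have "card (?p ` H) = order ?Q"
    proof (rule ccontr)
      assume "card (?p ` H) \<noteq> order ?Q"
      then have "card (?p ` H) < order ?Q" using le1 by simp
      then have "card (?p ` H) * primes_part \<sigma> (card I) < order ?Q * primes_part \<sigma> (card I)"
        using pos by simp
      moreover have "card (?p ` H) * card (H \<inter> I) \<le> card (?p ` H) * primes_part \<sigma> (card I)"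
        using le2 by simp
      ultimately show False using a cH2 by (metis leD le_less_trans mult.commute)
    qed
    moreover from this have "card (H \<inter> I) = primes_part \<sigma> (card I)"
      using a cH2 le2 cQ by (metis le_antisym mult.commute mult_le_cancel1)
    ultimately show ?thesis by simp
  qed
  then show "?p ` H = carrier ?Q" and "card (H \<inter> I) = primes_part \<sigma> (card I)"
    using card_subset_eq[OF finQ sub] by (auto simp: order_def)
qed

lemma carrier_eq_ideal_add_if_surjective:
  assumes I: "brace_ideal I X" and H: "subskew_brace H X"
    and surj: "(\<lambda>x. I +> x) ` H = carrier (brace_quotient X I)"
  shows "carrier X = I <+> H"
proof
  have sa: "subgroup H (add_monoid X)" and ia: "subgroup I (add_monoid X)"
    using H I by (auto simp: subskew_brace_def brace_ideal_def)
  show "I <+> H \<subseteq> carrier X"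
    using subgroup.subset[OF sa] subgroup.subset[OF ia] by (auto simp: set_add_def set_mult_def)
  show "carrier X \<subseteq> I <+> H"
  proof
    fix x assume x: "x \<in> carrier X"
    then have "I +> x \<in> (\<lambda>x. I +> x) ` H" using surj brace_quotient_simps(1)[OF I] by blast
    then obtain h where h: "h \<in> H" "I +> x = I +> h" by blast
    have "x \<in> I +> x"
      using group.rcos_self[OF additive_group _ ia] x by (simp add: a_r_coset_def)
    then have "x \<in> I +> h" using h(2) by simp
    then show "x \<in> I <+> H" using h(1) by (auto simp: a_r_coset_def r_coset_def set_add_def set_mult_def)
  qed
qed

text \<open>
  Additive and multiplicative cosets of an ideal agree, so the first isomorphism theorem for the two
  group structures produces the same map on \<open>H/(H \<inter> I)\<close>, which is therefore an isomorphism of skew braces.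
\<close>

lemma brace_quotient_isomorphic_if_surjective:
  assumes I: "brace_ideal I X" and H: "subskew_brace H X"
    and surj: "(\<lambda>x. I +> x) ` H = carrier (brace_quotient X I)"
  shows "brace_isomorphic (brace_quotient (X\<lparr>carrier := H\<rparr>) (H \<inter> I)) (brace_quotient X I)"
proof -
  let ?Y = "X\<lparr>carrier := H\<rparr>" and ?Q = "brace_quotient X I" and ?p = "\<lambda>x. I +> x"
  interpret Y: skew_brace ?Y by (rule subskew_brace_is_skew_brace[OF H])
  have HX: "H \<subseteq> carrier X" using H subgroup.subset[of H X] by (auto simp: subskew_brace_def)
  have J: "brace_ideal (H \<inter> I) ?Y" by (rule ideal_Int_subskew_brace[OF H I])
  note s = Y.brace_quotient_simps[OF J]
  interpret pa: group_hom "add_monoid X" "add_monoid ?Q" ?p by (rule brace_quotient_projection(1)[OF I])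
  interpret pm: group_hom X ?Q ?p by (rule brace_quotient_projection(2)[OF I])
  have ha: "group_hom (add_monoid ?Y) (add_monoid ?Q) ?p"
    using Y.additive_group brace_quotient_groups(1)[OF I] pa.homh HX
    by (auto simp: group_hom_def group_hom_axioms_def hom_def Pi_iff subset_iff)
  have hm: "group_hom ?Y ?Q ?p"
    using Y.multiplicative_group brace_quotient_groups(2)[OF I] pm.homh HX
    by (auto simp: group_hom_def group_hom_axioms_def hom_def Pi_iff subset_iff)
  have ka: "kernel (add_monoid ?Y) (add_monoid ?Q) ?p = H \<inter> I"
    using ideal_coset_eq_iff[OF I] brace_quotient_simps(6)[OF I] HX by (auto simp: kernel_def)
  have km: "kernel ?Y ?Q ?p = H \<inter> I"
    using ideal_coset_eq_iff[OF I] brace_quotient_simps(7)[OF I] HX by (auto simp: kernel_def)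
  let ?f = "\<lambda>C. the_elem (?p ` C)"
  have "?f \<in> iso (add_monoid ?Y Mod (H \<inter> I)) (add_monoid ?Q)"
    using group_hom.FactGroup_iso_set[OF ha] surj ka by simp
  moreover have "iso (add_monoid (brace_quotient ?Y (H \<inter> I))) (add_monoid ?Q) = iso (add_monoid ?Y Mod (H \<inter> I)) (add_monoid ?Q)"
    by (rule iso_cong) (use s(2,5) in simp_all)
  moreover have "?f \<in> iso (?Y Mod (H \<inter> I)) ?Q"
    using group_hom.FactGroup_iso_set[OF hm] surj km by simp
  moreover have "iso (brace_quotient ?Y (H \<inter> I)) ?Q = iso (?Y Mod (H \<inter> I)) ?Q"
    by (rule iso_cong) (use s(3,4) in simp_all)
  ultimately show ?thesis unfolding brace_isomorphic_def by blast
qed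

end

section \<open>Existence of Hall subskew braces\<close>

context skew_brace
begin

text \<open>
  The semidirect product of the additive group by the multiplicative group acting through \<open>\<lambda>\<close>. Its point
  is the diagonal: \<open>g \<mapsto> (g, g)\<close> is a homomorphism exactly because \<open>g + \<lambda>\<^sub>g(h) = g \<cdot> h\<close>.
\<close>

definition semidirect :: "('a \<times> 'a) monoid" where
  "semidirect = \<lparr>carrier = carrier X \<times> carrier X,
     mult = (\<lambda>(a, g) (b, h). (a \<oplus> brace_lambda X g b, g \<otimes> h)), one = (\<zero>, \<one>)\<rparr>"

lemma semidirect_simps [simp]:
  "carrier semidirect = carrier X \<times> carrier X"
  "(a, g) \<otimes>\<^bsub>semidirect\<^esub> (b, h) = (a \<oplus> brace_lambda X g b, g \<otimes> h)"
  "\<one>\<^bsub>semidirect\<^esub> = (\<zero>, \<one>)"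
  by (auto simp: semidirect_def)

lemma group_semidirect: "group semidirect"
proof (rule groupI)
  fix x assume "x \<in> carrier semidirect"
  then obtain a g where x: "x = (a, g)" "a \<in> carrier X" "g \<in> carrier X" by auto
  have "brace_lambda X (inv g) (\<ominus> a) \<oplus> brace_lambda X (inv g) a = \<zero>"
    using lambda_add[of "inv g" "\<ominus> a" a] lambda_zero[of "inv g"] x by simp
  then show "\<exists>y\<in>carrier semidirect. y \<otimes>\<^bsub>semidirect\<^esub> x = \<one>\<^bsub>semidirect\<^esub>"
    using x by (intro bexI[of _ "(brace_lambda X (inv g) (\<ominus> a), inv g)"]) auto
qed (auto simp: lambda_add lambda_mult add.m_assoc mult.m_assoc)

sublocale semidirect: group semidirect by (rule group_semidirect)

lemma semidirect_homs:
  "group_hom (add_monoid X) semidirect (\<lambda>a. (a, \<one>))"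
  "group_hom X semidirect (\<lambda>g. (\<zero>, g))"
  "group_hom X semidirect (\<lambda>g. (g, g))"
  "group_hom semidirect X snd"
  by (auto simp: group_hom_def group_hom_axioms_def hom_def additive_group multiplicative_group
      group_semidirect lambda_zero mult_eq_add_lambda[symmetric])

lemma solvable_semidirect:
  assumes "solvable (add_monoid X)" "solvable X"
  shows "solvable semidirect"
proof (rule solvable_condition[OF semidirect_homs(1,4) _ _ assms])
  show "snd ` carrier semidirect = carrier X" by force
  show "kernel semidirect X snd \<subseteq> (\<lambda>a. (a, \<one>)) ` carrier (add_monoid X)"
    by (auto simp: kernel_def)
qed

text \<open>
  The group is the product of its multiplicative factor and its diagonal. Writing \<open>z = (a, k)\<close>, the
  equation forces \<open>g\<^sup>-\<^sup>1 + a = k\<close>, which is where the witness \<open>u = k - a\<close> for \<open>g\<^sup>-\<^sup>1\<close> comes from.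
\<close>

lemma semidirect_factorisation:
  assumes z: "z \<in> carrier semidirect"
  obtains g d where "g \<in> carrier X" "d \<in> carrier X" "(\<zero>, g) \<otimes>\<^bsub>semidirect\<^esub> z = (d, d)"
proof -
  obtain a k where ak: "z = (a, k)" "a \<in> carrier X" "k \<in> carrier X" using z by auto
  define u where "u = k \<oplus> \<ominus> a"
  define d where "d = inv u \<otimes> k"
  have u: "u \<in> carrier X" and d: "d \<in> carrier X" using ak by (auto simp: u_def d_def)
  have "u \<otimes> d = k" using ak u by (simp add: d_def mult.m_assoc[symmetric])
  then have "brace_lambda X u d = a"
    using ak by (simp add: brace_lambda_def u_def add.inv_mult_group add.m_assoc)
  then have "brace_lambda X (inv u) a = d"
    using lambda_mult[of "inv u" u d] u d by simp
  then have "(\<zero>, inv u) \<otimes>\<^bsub>semidirect\<^esub> z = (d, d)" using ak u d by (simp add: d_def)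
  then show ?thesis using that u d by blast
qed

text \<open>
  Let \<open>B\<close> be a Hall subgroup of the multiplicative group and embed it into the semidirect product twice,
  as \<open>(0, b)\<close> and as \<open>(b, b)\<close>. Both copies are conjugate into one Hall subgroup \<open>S\<close>. The factorisation
  above lets both conjugations be replaced by conjugations inside the multiplicative factor and inside
  the diagonal, at the price of replacing \<open>S\<close> by a conjugate \<open>T\<close>. Then \<open>T\<close> contains all \<open>(0, c)\<close> and
  all \<open>(e, e)\<close>, where \<open>c\<close> and \<open>e\<close> range over two conjugates of \<open>B\<close>. The projection of \<open>T\<close> to the multiplicative group is too small to
  be larger than either of them, so these conjugates are the same set \<open>H\<close>. From \<open>(c, c) (0, c)\<^sup>-\<^sup>1 = (c, 1)\<close>
  it follows that \<open>H\<close> lies in the additive part of \<open>T\<close>, which again has no room to be larger. So \<open>H\<close> is a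
  subgroup of both groups.
\<close>

theorem hall_subskew_brace_exists:
  assumes fin: "finite (carrier X)" and solv: "solvable (add_monoid X)" "solvable X"
  shows "\<exists>H. hall_subskew_brace \<sigma> H X"
proof -
  let ?G = semidirect
  interpret iA: group_hom "add_monoid X" ?G "\<lambda>a. (a, \<one>)" by (rule semidirect_homs)
  interpret iM: group_hom X ?G "\<lambda>g. (\<zero>, g)" by (rule semidirect_homs)
  interpret iD: group_hom X ?G "\<lambda>g. (g, g)" by (rule semidirect_homs)
  interpret sn: group_hom ?G X snd by (rule semidirect_homs)
  have finG: "finite (carrier ?G)" using fin by simp
  have posX: "order X > 0" using fin mult.order_gt_0_iff_finite by simp
  obtain B where B: "hall_subgroup \<sigma> B X"
    using mult.hall_theorem_solvable[OF fin solv(2)] unfolding hall_theorem_holds_def by blast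
  have subB: "subgroup B X" and suppB: "prime_support_in \<sigma> (card B)"
    using B by (auto simp: hall_subgroup_def)
  have cardB: "primes_part \<sigma> (order X) = card B"
    using primes_part_eqI[OF posX mult.card_subgroup_dvd_order[OF subB] suppB] B
    by (simp add: hall_subgroup_def)
  have BX: "b \<in> carrier X" if "b \<in> B" for b using subgroup.mem_carrier[OF subB that] .
  have finB: "finite B" using finite_subset[OF subgroup.subset[OF subB] fin] .
  obtain S where S: "hall_subgroup \<sigma> S ?G"
    and conjS: "\<And>U. subgroup U ?G \<Longrightarrow> prime_support_in \<sigma> (card U) \<Longrightarrow>
      \<exists>g\<in>carrier ?G. \<forall>u\<in>U. g \<otimes>\<^bsub>?G\<^esub> u \<otimes>\<^bsub>?G\<^esub> inv\<^bsub>?G\<^esub> g \<in> S"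
    using semidirect.hall_theorem_solvable[OF finG solvable_semidirect[OF solv]]
    unfolding hall_theorem_holds_def by blast
  have subS: "subgroup S ?G" and suppS: "prime_support_in \<sigma> (card S)"
    using S by (auto simp: hall_subgroup_def)
  have finS: "finite S" using finite_subset[OF subgroup.subset[OF subS] finG] .
  obtain x where x: "x \<in> carrier ?G"
    "\<And>b. b \<in> B \<Longrightarrow> x \<otimes>\<^bsub>?G\<^esub> (\<zero>, b) \<otimes>\<^bsub>?G\<^esub> inv\<^bsub>?G\<^esub> x \<in> S"
    using conjS[OF iM.subgroup_img_is_subgroup[OF subB]]
      prime_support_in_dvd[OF suppB iM.card_image_dvd_card[OF subB finB]] by blast
  obtain y where y: "y \<in> carrier ?G"
    "\<And>b. b \<in> B \<Longrightarrow> y \<otimes>\<^bsub>?G\<^esub> (b, b) \<otimes>\<^bsub>?G\<^esub> inv\<^bsub>?G\<^esub> y \<in> S"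
    using conjS[OF iD.subgroup_img_is_subgroup[OF subB]]
      prime_support_in_dvd[OF suppB iD.card_image_dvd_card[OF subB finB]] by blast
  obtain g d where g: "g \<in> carrier X" and d: "d \<in> carrier X"
    and gd: "(\<zero>, g) \<otimes>\<^bsub>?G\<^esub> (inv\<^bsub>?G\<^esub> x \<otimes>\<^bsub>?G\<^esub> y) = (d, d)"
    using semidirect_factorisation[of "inv\<^bsub>?G\<^esub> x \<otimes>\<^bsub>?G\<^esub> y"] x(1) y(1)
    by (metis semidirect.inv_closed semidirect.m_closed)
  \<comment> \<open>The choice of \<open>w\<close> makes \<open>w x = (0, g)\<close> and \<open>w y = (d, d)\<close>.\<close>
  define w where "w = (\<zero>, g) \<otimes>\<^bsub>?G\<^esub> inv\<^bsub>?G\<^esub> x"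
  have gG: "(\<zero>, g) \<in> carrier ?G" using g by auto
  have w: "w \<in> carrier ?G" unfolding w_def using gG x(1) by (rule semidirect.m_closed[OF _ semidirect.inv_closed])
  have wx: "w \<otimes>\<^bsub>?G\<^esub> x = (\<zero>, g)"
    unfolding w_def using gG x(1) by (metis semidirect.inv_closed semidirect.l_inv semidirect.m_assoc semidirect.r_one)
  have wy: "w \<otimes>\<^bsub>?G\<^esub> y = (d, d)"
    unfolding w_def using gd gG x(1) y(1) by (metis semidirect.inv_closed semidirect.m_assoc)
  define T where "T = (\<lambda>s. w \<otimes>\<^bsub>?G\<^esub> s \<otimes>\<^bsub>?G\<^esub> inv\<^bsub>?G\<^esub> w) ` S"
  interpret cw: group_hom ?G ?G "\<lambda>s. w \<otimes>\<^bsub>?G\<^esub> s \<otimes>\<^bsub>?G\<^esub> inv\<^bsub>?G\<^esub> w"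
    by (rule semidirect.conjugation_group_hom[OF w])
  have subT: "subgroup T ?G" unfolding T_def by (rule cw.subgroup_img_is_subgroup[OF subS])
  have suppT: "prime_support_in \<sigma> (card T)"
    unfolding T_def using prime_support_in_dvd[OF suppS cw.card_image_dvd_card[OF subS finS]] .
  have finT: "finite T" unfolding T_def using finS by simp
  have conj_conj: "w \<otimes>\<^bsub>?G\<^esub> (v \<otimes>\<^bsub>?G\<^esub> u \<otimes>\<^bsub>?G\<^esub> inv\<^bsub>?G\<^esub> v) \<otimes>\<^bsub>?G\<^esub> inv\<^bsub>?G\<^esub> w
      = (w \<otimes>\<^bsub>?G\<^esub> v) \<otimes>\<^bsub>?G\<^esub> u \<otimes>\<^bsub>?G\<^esub> inv\<^bsub>?G\<^esub> (w \<otimes>\<^bsub>?G\<^esub> v)"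
    if "v \<in> carrier ?G" "u \<in> carrier ?G" for u v
    by (rule semidirect.conjugation_comp[OF w that])
  have T1: "(\<zero>, g \<otimes> b \<otimes> inv g) \<in> T" if b: "b \<in> B" for b
  proof -
    have bG: "(\<zero>, b) \<in> carrier ?G" using BX[OF b] by simp
    have "(\<zero>, g) \<otimes>\<^bsub>?G\<^esub> (\<zero>, b) \<otimes>\<^bsub>?G\<^esub> inv\<^bsub>?G\<^esub> (\<zero>, g) \<in> T"
      unfolding T_def wx[symmetric] conj_conj[OF x(1) bG, symmetric] using x(2)[OF b] by (rule imageI)
    moreover have "(\<zero>, g \<otimes> b \<otimes> inv g) = (\<zero>, g) \<otimes>\<^bsub>?G\<^esub> (\<zero>, b) \<otimes>\<^bsub>?G\<^esub> inv\<^bsub>?G\<^esub> (\<zero>, g)"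
      unfolding iM.hom_inv[OF g, symmetric]
      using iM.hom_mult[of "g \<otimes> b" "inv g"] iM.hom_mult[of g b] g BX[OF b] by (metis mult.inv_closed mult.m_closed)
    ultimately show ?thesis by argo
  qed
  have T2: "(d \<otimes> b \<otimes> inv d, d \<otimes> b \<otimes> inv d) \<in> T" if b: "b \<in> B" for b
  proof -
    have bG: "(b, b) \<in> carrier ?G" using BX[OF b] by simp
    have "(d, d) \<otimes>\<^bsub>?G\<^esub> (b, b) \<otimes>\<^bsub>?G\<^esub> inv\<^bsub>?G\<^esub> (d, d) \<in> T"
      unfolding T_def wy[symmetric] conj_conj[OF y(1) bG, symmetric] using y(2)[OF b] by (rule imageI)
    moreover have "(d \<otimes> b \<otimes> inv d, d \<otimes> b \<otimes> inv d) = (d, d) \<otimes>\<^bsub>?G\<^esub> (b, b) \<otimes>\<^bsub>?G\<^esub> inv\<^bsub>?G\<^esub> (d, d)"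
      unfolding iD.hom_inv[OF d, symmetric]
      using iD.hom_mult[of "d \<otimes> b" "inv d"] iD.hom_mult[of d b] d BX[OF b] by (metis mult.inv_closed mult.m_closed)
    ultimately show ?thesis by argo
  qed
  define H where "H = snd ` T"
  have subH: "subgroup H X" unfolding H_def by (rule sn.subgroup_img_is_subgroup[OF subT])
  have finH: "finite H" unfolding H_def using finT by simp
  have cardH_le: "card H \<le> card B"
    unfolding cardB[symmetric]
    by (rule primes_part_properties(3)[OF posX mult.card_subgroup_dvd_order[OF subH]])
      (use prime_support_in_dvd[OF suppT sn.card_image_dvd_card[OF subT finT]] in \<open>simp add: H_def\<close>)
  have conj_all: "(\<lambda>b. c \<otimes> b \<otimes> inv c) ` B = H" if c: "c \<in> carrier X" and sub: "(\<lambda>b. c \<otimes> b \<otimes> inv c) ` B \<subseteq> H" for c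
  proof (rule card_seteq[OF finH sub])
    have "inj_on (\<lambda>b. c \<otimes> b \<otimes> inv c) B"
      using c BX by (simp add: inj_on_def)
    then show "card H \<le> card ((\<lambda>b. c \<otimes> b \<otimes> inv c) ` B)" using cardH_le by (simp add: card_image)
  qed
  have Hg: "(\<lambda>b. g \<otimes> b \<otimes> inv g) ` B = H"
    by (rule conj_all[OF g]) (use T1 in \<open>force simp: H_def\<close>)
  have Hd: "(\<lambda>b. d \<otimes> b \<otimes> inv d) ` B = H"
    by (rule conj_all[OF d]) (use T2 in \<open>force simp: H_def\<close>)
  have cardH: "card H = card B"
  proof -
    have "inj_on (\<lambda>b. g \<otimes> b \<otimes> inv g) B" using g BX by (simp add: inj_on_def)
    then show ?thesis using Hg card_image by metis
  qed
  define A where "A = {a \<in> carrier (add_monoid X). (a, \<one>) \<in> T}"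
  have subA: "subgroup A (add_monoid X)" unfolding A_def by (rule iA.subgroup_preimage[OF subT])
  have AX: "A \<subseteq> carrier X" by (auto simp: A_def)
  have finA: "finite A" using AX fin finite_subset by blast
  have "card A \<le> card B"
    unfolding cardB[symmetric]
  proof (rule primes_part_properties(3)[OF posX])
    show "card A dvd order X"
      using group.card_subgroup_dvd_order[OF additive_group subA] by (simp add: order_def)
    have img: "(\<lambda>a. (a, \<one>)) ` A \<subseteq> T" by (auto simp: A_def)
    have "subgroup ((\<lambda>a. (a, \<one>)) ` A) (?G\<lparr>carrier := T\<rparr>)"
      by (rule semidirect.subgroup_incl[OF iA.subgroup_img_is_subgroup[OF subA] subT img])
    then have "card ((\<lambda>a. (a, \<one>)) ` A) dvd card T"
      using group.card_subgroup_dvd_order[OF subgroup.subgroup_is_group[OF subT group_semidirect]]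
      by (fastforce simp: order_def)
    moreover have "card ((\<lambda>a. (a, \<one>)) ` A) = card A" by (rule card_image) (simp add: inj_on_def)
    ultimately show "prime_support_in \<sigma> (card A)" using prime_support_in_dvd[OF suppT] by simp
  qed
  moreover have "H \<subseteq> A"
  proof
    fix c assume c: "c \<in> H"
    then have cX: "c \<in> carrier X" using subgroup.mem_carrier[OF subH] by blast
    have zc: "(\<zero>, c) \<in> T" using c T1 unfolding Hg[symmetric] by blast
    have cc: "(c, c) \<in> T" using c T2 unfolding Hd[symmetric] by blast
    have "(c, c) \<otimes>\<^bsub>?G\<^esub> inv\<^bsub>?G\<^esub> (\<zero>, c) = (c, \<one>)"
      unfolding iM.hom_inv[OF cX, symmetric] semidirect_simps(2)
      by (simp only: lambda_zero mult.r_inv add.r_one cX)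
    then show "c \<in> A"
      using subgroup.m_closed[OF subT cc subgroup.m_inv_closed[OF subT zc]] cX by (simp add: A_def)
  qed
  ultimately have "H = A" using card_seteq[OF finA] cardH by simp
  then have "hall_subskew_brace \<sigma> H X"
    using subA subH cardH cardB by (simp add: hall_subskew_brace_def subskew_brace_def)
  then show ?thesis ..
qed

end

theorem corollary8p6:
  fixes X :: "('a, 'm) ring_scheme"
    and R :: "'a set" and Q :: "'a set ring" and \<sigma> :: "nat set"
  assumes "skew_brace X" and "finite (carrier X)"
    and "R = left_nilpotent_residual X"
    and "Q = brace_quotient X R"
    and "\<sigma> = prime_divisors_of_order Q"
  shows "(\<forall>H. hall_subskew_brace \<sigma> H X \<longrightarrow>
            carrier X = R <+>\<^bsub>X\<^esub> H \<and>
            card (H \<inter> R) = primes_part \<sigma> (card R) \<and>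
            brace_isomorphic (brace_quotient (X\<lparr>carrier := H\<rparr>) (H \<inter> R)) Q \<and>
            left_nilpotent_residual (X\<lparr>carrier := H\<rparr>) \<subseteq> H \<inter> R) \<and>
         (solvable (add_monoid X) \<and> solvable X \<longrightarrow> (\<exists>H. hall_subskew_brace \<sigma> H X))"
proof -
  interpret skew_brace X by fact
  note fin = \<open>finite (carrier X)\<close>
  have R: "brace_ideal R X" using left_nilpotent_residual_ideal assms(3) by simp
  have supp: "prime_support_in \<sigma> (order (brace_quotient X R))"
    using assms(4,5) by (simp add: prime_support_in_def prime_divisors_of_order_def)
  have "carrier X = R <+>\<^bsub>X\<^esub> H \<and> card (H \<inter> R) = primes_part \<sigma> (card R) \<and>
      brace_isomorphic (brace_quotient (X\<lparr>carrier := H\<rparr>) (H \<inter> R)) Q \<and>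
      left_nilpotent_residual (X\<lparr>carrier := H\<rparr>) \<subseteq> H \<inter> R"
    if hall: "hall_subskew_brace \<sigma> H X" for H
  proof -
    have H: "subskew_brace H X" using hall by (simp add: hall_subskew_brace_def)
    note count = hall_subskew_brace_supplements_ideal[OF fin R hall supp]
    show ?thesis
      using carrier_eq_ideal_add_if_surjective[OF R H count(1)] count(2)
        brace_quotient_isomorphic_if_surjective[OF R H count(1)]
        residual_of_subskew_brace[OF fin H] assms(3,4)
      by blast
  qed
  then show ?thesis using hall_subskew_brace_exists[OF fin] by blast
qed

end
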